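(* Let $(V,A)$ be an affine projective Osserman curvature model of odd dimension $m=\dim V$. If $0\ne v\in V$, then $\operatorname{Spec}\{\mathcal{J}(v)\}=\{0,\lambda(v)\}$, where $\lambda$ is a smooth real-valued function on $V\setminus\{0\}$ which never vanishes. The eigenvalue $0$ appears with multiplicity $1$ and the eigenvalue $\lambda(v)$ appears with multiplicity $m-1$. In this situation $\rho(v,v)=(m-1)\lambda(v)$, so the symmetric Ricci tensor $\rho_s$ defines a non-degenerate definite inner product on $V$ (i.e. $\rho_s$ is positive definite or negative definite).
   Context: An affine curvature model $(V,A)$ is a finite-dimensional real vector space $V$ together with a bilinear map $A:V\times V\to\operatorname{End}(V)$ such that for all $x,y,z\in V$: $A(x,y)z=-A(y,x)z$ and $A(x,y)z+A(y,z)x+A(z,x)y=0$. Its Jacobi operator is $\mathcal{J}(v)w:=A(w,v)v$, for $v,w\in V$. For a linear map $T$ of a finite-dimensional real vector space, $\operatorname{Spec}\{T\}\subset\mathbb{C}$ is the set of complex roots of the characteristic polynomial $\det(T-\lambda\operatorname{Id})$; multiplicities are algebraic multiplicities, i.e. as roots of the characteristic polynomial. $(V,A)$ is an affine projective Osserman curvature model if for all non-zero $v,w\in V$ there is a real number $s(v,w)\neq0$ such that $\operatorname{Spec}\{\mathcal{J}(v)\}=s(v,w)\cdot\operatorname{Spec}\{\mathcal{J}(w)\}\ne\{0\}$. The Ricci tensor is $\rho(x,y):=\operatorname{Tr}\{z\mapsto A(z,x)y\}$ and $\rho_s(x,y):=\frac12\{\rho(x,y)+\rho(y,x)\}$ is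 its symmetric part. *)

theory Defs
  imports "HOL-Analysis.Analysis" "Jordan_Normal_Form.Char_Poly"
begin

text \<open>
  The space \<open>V\<close> is a type \<open>'a::euclidean_space\<close>, of dimension \<open>DIM('a)\<close>. Its inner product
  is auxiliary: it only supplies the topology of \<open>V\<close> and the orthonormal basis \<open>Basis\<close> in which
  the trace and the characteristic polynomial, both independent of the basis, are computed.
\<close>

subsection \<open>Trace, characteristic polynomial and spectrum of an endomorphism\<close>

definition basis_list :: "'a::euclidean_space list" where
  "basis_list = (SOME bs. distinct bs \<and> set bs = Basis)"

lemma basis_list:
  "distinct (basis_list :: 'a list) \<and> set basis_list = (Basis :: 'a::euclidean_space set)"
proof -
  have "\<exists>bs. distinct bs \<and> set bs = (Basis :: 'a set)"
    using finite_distinct_list[OF finite_Basis] by blast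
  then show ?thesis
    unfolding basis_list_def by (rule someI_ex)
qed

definition mat_of_lin :: "('a::euclidean_space \<Rightarrow> 'a) \<Rightarrow> real mat" where
  "mat_of_lin T =
     Matrix.mat DIM('a) DIM('a) (\<lambda>(i, j). T (basis_list ! j) \<bullet> (basis_list ! i))"

definition lin_trace :: "('a::euclidean_space \<Rightarrow> 'a) \<Rightarrow> real" where
  "lin_trace T = (\<Sum>b\<in>Basis. T b \<bullet> b)"

text \<open>
  The library's \<open>char_poly\<close> is \<open>det (\<lambda> Id - T)\<close>; it differs from \<open>det (T - \<lambda> Id)\<close>
  by the sign \<open>(-1) ^ DIM('a)\<close>, so the roots and their multiplicities agree.
\<close>

definition lin_char_poly :: "('a::euclidean_space \<Rightarrow> 'a) \<Rightarrow> complex poly" where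
  "lin_char_poly T = map_poly complex_of_real (char_poly (mat_of_lin T))"

definition Spec :: "('a::euclidean_space \<Rightarrow> 'a) \<Rightarrow> complex set" where
  "Spec T = {z. poly (lin_char_poly T) z = 0}"

definition alg_mult :: "('a::euclidean_space \<Rightarrow> 'a) \<Rightarrow> complex \<Rightarrow> nat" where
  "alg_mult T z = order z (lin_char_poly T)"

subsection \<open>Affine curvature models\<close>

definition affine_curvature_model ::
    "('a::euclidean_space \<Rightarrow> 'a \<Rightarrow> 'a \<Rightarrow> 'a) \<Rightarrow> bool" where
  "affine_curvature_model A \<longleftrightarrow>
     (\<forall>x y. linear (A x y)) \<and>
     (\<forall>z. bilinear (\<lambda>x y. A x y z)) \<and>
     (\<forall>x y z. A x y z = - A y x z) \<and>
     (\<forall>x y z. A x y z + A y z x + A z x y = 0)"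

definition Jacobi_op ::
    "('a::euclidean_space \<Rightarrow> 'a \<Rightarrow> 'a \<Rightarrow> 'a) \<Rightarrow> 'a \<Rightarrow> 'a \<Rightarrow> 'a" where
  "Jacobi_op A v w = A w v v"

definition affine_projective_Osserman ::
    "('a::euclidean_space \<Rightarrow> 'a \<Rightarrow> 'a \<Rightarrow> 'a) \<Rightarrow> bool" where
  "affine_projective_Osserman A \<longleftrightarrow>
     affine_curvature_model A \<and>
     (\<forall>v w. v \<noteq> 0 \<longrightarrow> w \<noteq> 0 \<longrightarrow>
        (\<exists>s::real. s \<noteq> 0 \<and>
           Spec (Jacobi_op A v) = (\<lambda>z. complex_of_real s * z) ` Spec (Jacobi_op A w) \<and>
           (\<lambda>z. complex_of_real s * z) ` Spec (Jacobi_op A w) \<noteq> {0}))"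

definition Ricci ::
    "('a::euclidean_space \<Rightarrow> 'a \<Rightarrow> 'a \<Rightarrow> 'a) \<Rightarrow> 'a \<Rightarrow> 'a \<Rightarrow> real" where
  "Ricci A x y = lin_trace (\<lambda>z. A z x y)"

definition Ricci_sym ::
    "('a::euclidean_space \<Rightarrow> 'a \<Rightarrow> 'a \<Rightarrow> 'a) \<Rightarrow> 'a \<Rightarrow> 'a \<Rightarrow> real" where
  "Ricci_sym A x y = (Ricci A x y + Ricci A y x) / 2"

definition definite_inner_product :: "('a::real_vector \<Rightarrow> 'a \<Rightarrow> real) \<Rightarrow> bool" where
  "definite_inner_product B \<longleftrightarrow>
     bilinear B \<and>
     (\<forall>x y. B x y = B y x) \<and>
     (\<forall>x. (\<forall>y. B x y = 0) \<longrightarrow> x = 0) \<and>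
     ((\<forall>x. x \<noteq> 0 \<longrightarrow> B x x > 0) \<or> (\<forall>x. x \<noteq> 0 \<longrightarrow> B x x < 0))"

subsection \<open>Smooth functions\<close>

text \<open>
  Intended for open \<open>S\<close>. In finite dimension, asking that each directional derivative
  \<open>x \<mapsto> D f x v\<close> be \<open>C^n\<close> is the same as asking it of the derivative \<open>D f\<close> itself.
\<close>

primrec Ck_on ::
    "nat \<Rightarrow> ('a::euclidean_space \<Rightarrow> 'b::real_normed_vector) \<Rightarrow> 'a set \<Rightarrow> bool" where
  "Ck_on 0 f S \<longleftrightarrow> continuous_on S f"
| "Ck_on (Suc n) f S \<longleftrightarrow>
     (\<forall>x\<in>S. f differentiable (at x)) \<and>
     (\<forall>v. Ck_on n (\<lambda>x. frechet_derivative f (at x) v) S)"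

definition smooth_on ::
    "('a::euclidean_space \<Rightarrow> 'b::real_normed_vector) \<Rightarrow> 'a set \<Rightarrow> bool" where
  "smooth_on f S \<longleftrightarrow> (\<forall>n. Ck_on n f S)"

end

theory Submission
  imports
    Defs
    "HOL-Computational_Algebra.Field_as_Ring"
    "HOL-Homology.Brouwer_Degree"
begin

text \<open>
  Since \<open>J(v) v = 0\<close>, the Jacobi operator \<open>J(v)\<close> of a unit vector acts on the quotient
  \<open>V / \<real>v\<close>, which is the tangent space \<open>v\<^sup>\<bottom>\<close> of the unit sphere at \<open>v\<close>. All of the theorem
  follows once this induced action is known to have a single eigenvalue, real and non-zero, and
  that is a matter of topology, because the unit sphere of an odd-dimensional space has no
  nowhere vanishing tangent field.

  \<^emph>\<open>Normalisation.\<close> The Osserman condition fixes \<open>Spec J(v)\<close> up to a real factor. The absolute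
  value of the factor is a quotient of spectral radii, hence continuous; its sign cannot change on
  the connected sphere (unless the spectrum is symmetric, when the sign does not matter). So
  \<open>T(v) = J(v) / r(v)\<close>, with \<open>r(v)\<close> the spectral radius, is a continuous family of operators with
  one and the same spectrum \<open>\<Sigma>\<close> (lemma \<open>Spec_scaled_by_spectral_radius\<close>).

  \<^emph>\<open>The tangent bundle does not split.\<close> Let \<open>l \<in> \<Sigma>\<close> be non-zero. Because \<open>\<Sigma>\<close> is constant,
  one fixed polynomial \<open>p\<close>, evaluated at \<open>T(v)\<close>, is for every \<open>v\<close> the projection to the
  generalised eigenspaces of \<open>l\<close> and its conjugate. It induces a continuous family of non-zero
  projections of the tangent spaces. Were it proper at one point \<open>u\<close>, then a section of its image,
  defined away from \<open>u\<close>, and a section of its kernel, defined near \<open>u\<close>, would add up with a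
  cut-off function to a nowhere vanishing tangent field (theorem \<open>tangent_projection_trivial\<close>).
  Hence \<open>\<Sigma>\<close> has no element besides \<open>0\<close>, \<open>l\<close> and the conjugate of \<open>l\<close>, and \<open>0\<close> is not an
  eigenvalue on \<open>V / \<real>v\<close>.

  \<^emph>\<open>The eigenvalue is real.\<close> If \<open>l\<close> were not real, a suitable polynomial in \<open>T(v)\<close> would give a
  complex structure on each tangent space, the same at \<open>v\<close> and at \<open>-v\<close> since
  \<open>J(-v) = J(v)\<close>. Complex structures orient the tangent spaces continuously, whereas the antipodal
  points \<open>v\<close> and \<open>-v\<close> must give opposite orientations of \<open>v\<^sup>\<bottom>\<close>
  (theorem \<open>no_antipodal_complex_structure\<close>).

  \<^emph>\<open>Conclusion.\<close> Taking traces, \<open>\<rho>(v,v) = Tr J(v) = (m - 1) \<lambda>(v)\<close>, which fixes the multiplicities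
  and shows that \<open>\<lambda>\<close> is the restriction of a quadratic form without zeros on the connected set
  \<open>V - {0}\<close>; such a form is smooth and definite.
\<close>

(* The dot stands for the inner product and the dollar sign for the entries of vec. *)
no_notation Matrix.scalar_prod (infix \<open>\<bullet>\<close> 70)
no_notation vec_nth (infixl \<open>$\<close> 90)

section \<open>Continuous families of linear maps, determinants and spectra\<close>

text \<open>
  Only pointwise continuity is asked for; in finite dimension it gives joint continuity in the
  parameter and the argument (\<open>linear_family_apply_continuous\<close>).
\<close>

definition linear_family :: "'p::topological_space set \<Rightarrow> ('p \<Rightarrow> 'a::euclidean_space \<Rightarrow> 'a) \<Rightarrow> bool" where
  "linear_family S F \<longleftrightarrow> (\<forall>p\<in>S. linear (F p)) \<and> (\<forall>x. continuous_on S (\<lambda>p. F p x))"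

lemma linear_familyD:
  assumes "linear_family S F"
  shows "p \<in> S \<Longrightarrow> linear (F p)" "continuous_on S (\<lambda>p. F p x)"
  using assms by (auto simp: linear_family_def)

lemma linear_basis_expansion:
  fixes T :: "'a::euclidean_space \<Rightarrow> 'b::real_vector"
  assumes "linear T"
  shows "T x = (\<Sum>b\<in>Basis. (x \<bullet> b) *\<^sub>R T b)"
  using assms by (metis (no_types, lifting) euclidean_representation linear_scale linear_sum sum.cong)

lemma linear_family_apply_continuous:
  fixes g :: "'p::topological_space \<Rightarrow> 'a::euclidean_space"
  assumes F: "linear_family S F" and g: "continuous_on S g"
  shows "continuous_on S (\<lambda>p. F p (g p))"
proof -
  have "continuous_on S (\<lambda>p. \<Sum>b\<in>Basis. (g p \<bullet> b) *\<^sub>R F p b)"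
    by (intro continuous_intros g linear_familyD(2)[OF F])
  then show ?thesis
    by (rule continuous_on_eq) (simp add: linear_basis_expansion[OF linear_familyD(1)[OF F], symmetric])
qed

lemma linear_family_id: "linear_family S (\<lambda>p x. x)"
  by (simp add: linear_family_def linear_ident)

lemma linear_family_compose:
  "linear_family S F \<Longrightarrow> linear_family S G \<Longrightarrow> linear_family S (\<lambda>p x. F p (G p x))"
  unfolding linear_family_def[of S "\<lambda>p x. F p (G p x)"]
  using linear_family_apply_continuous[of S F "\<lambda>p. G p x" for x] linear_familyD[of S F] linear_familyD[of S G]
  by (simp add: linear_compose[of "G p" "F p" for p, unfolded o_def])

lemma linear_family_add:
  "linear_family S F \<Longrightarrow> linear_family S G \<Longrightarrow> linear_family S (\<lambda>p x. F p x + G p x)"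
  by (auto simp: linear_family_def linear_compose_add intro!: continuous_intros)

lemma linear_family_diff:
  "linear_family S F \<Longrightarrow> linear_family S G \<Longrightarrow> linear_family S (\<lambda>p x. F p x - G p x)"
  by (auto simp: linear_family_def linear_compose_sub intro!: continuous_intros)

lemma linear_family_scaleR:
  "linear_family S F \<Longrightarrow> continuous_on S c \<Longrightarrow> linear_family S (\<lambda>p x. c p *\<^sub>R F p x)"
  by (auto simp: linear_family_def linear_compose_scale_right intro!: continuous_intros)

lemma linear_family_reparametrize:
  assumes "linear_family S F" "continuous_on D f" "f ` D \<subseteq> S"
  shows "linear_family D (\<lambda>q. F (f q))"
  using assms by (auto simp: linear_family_def image_subset_iff intro: continuous_on_compose2)

lemma linear_family_rank_one:
  fixes f g :: "'p::topological_space \<Rightarrow> 'a::euclidean_space"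
  assumes "continuous_on S f" "continuous_on S g"
  shows "linear_family S (\<lambda>p x. (f p \<bullet> x) *\<^sub>R g p)"
  using assms unfolding linear_family_def
  by (auto intro!: continuous_intros linearI simp: inner_add_right scaleR_add_left)

lemma sum_basis_list: "(\<Sum>i<DIM('a). f ((basis_list :: 'a::euclidean_space list) ! i)) = sum f Basis"
proof (rule sum.reindex_bij_betw)
  show "bij_betw ((!) (basis_list :: 'a list)) {..<DIM('a)} Basis"
    using basis_list[where 'a='a] distinct_card[of "basis_list :: 'a list"]
    by (metis bij_betw_nth)
qed

lemma basis_list_nth: "i < DIM('a) \<Longrightarrow> (basis_list :: 'a::euclidean_space list) ! i \<in> Basis"
  using basis_list[where 'a='a] distinct_card[of "basis_list :: 'a list"] by (metis nth_mem)

lemma basis_list_inner: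
  "i < DIM('a) \<Longrightarrow> j < DIM('a) \<Longrightarrow>
    (basis_list :: 'a::euclidean_space list) ! i \<bullet> basis_list ! j = (if i = j then 1 else 0)"
  using basis_list[where 'a='a] distinct_card[of "basis_list :: 'a list"] basis_list_nth[of i] basis_list_nth[of j]
  by (metis inner_Basis nth_eq_iff_index_eq)

definition complex_mat :: "('a::euclidean_space \<Rightarrow> 'a) \<Rightarrow> complex mat" where
  "complex_mat T = map_mat complex_of_real (mat_of_lin T)"

lemma mat_of_lin_carrier [simp]: "mat_of_lin (T :: 'a::euclidean_space \<Rightarrow> 'a) \<in> carrier_mat DIM('a) DIM('a)"
  by (simp add: mat_of_lin_def)

lemma complex_mat_carrier [simp]: "complex_mat (T :: 'a::euclidean_space \<Rightarrow> 'a) \<in> carrier_mat DIM('a) DIM('a)"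
  by (simp add: complex_mat_def)

lemma lin_char_poly_eq: "lin_char_poly T = char_poly (complex_mat T)"
  unfolding lin_char_poly_def complex_mat_def
  by (simp add: of_real_hom.char_poly_hom[OF mat_of_lin_carrier])

lemma degree_lin_char_poly:
  "degree (lin_char_poly (T :: 'a::euclidean_space \<Rightarrow> 'a)) = DIM('a)"
  "Polynomial.coeff (lin_char_poly T) DIM('a) = 1"
  using degree_monic_char_poly[OF complex_mat_carrier[of T]] by (simp_all add: lin_char_poly_eq)

lemma lin_char_poly_nonzero: "lin_char_poly (T :: 'a::euclidean_space \<Rightarrow> 'a) \<noteq> 0"
  using degree_lin_char_poly(2)[of T] by auto

lemma finite_Spec: "finite (Spec T)"
  unfolding Spec_def by (rule poly_roots_finite[OF lin_char_poly_nonzero])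

definition lin_det :: "('a::euclidean_space \<Rightarrow> 'a) \<Rightarrow> real" where
  "lin_det T = Determinant.det (mat_of_lin T)"

lemma continuous_on_det:
  fixes M :: "'p::topological_space \<Rightarrow> 'c::{real_normed_field} mat"
  assumes M: "\<And>p. p \<in> S \<Longrightarrow> M p \<in> carrier_mat n n"
    and cont: "\<And>i j. i < n \<Longrightarrow> j < n \<Longrightarrow> continuous_on S (\<lambda>p. M p $$ (i, j))"
  shows "continuous_on S (\<lambda>p. Determinant.det (M p))"
proof -
  have "continuous_on S (\<lambda>p. \<Sum>\<sigma>\<in>{\<sigma>. \<sigma> permutes {0..<n}}. signof \<sigma> * (\<Prod>i = 0..<n. M p $$ (i, \<sigma> i)))"
  proof (intro continuous_on_sum continuous_on_mult continuous_on_prod continuous_on_const)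
    fix \<sigma> i assume "\<sigma> \<in> {\<sigma>. \<sigma> permutes {0..<n}}" and i: "i \<in> {0..<n}"
    then have "\<sigma> permutes {0..<n}" by simp
    from permutes_in_image[OF this, of i] i show "continuous_on S (\<lambda>p. M p $$ (i, \<sigma> i))"
      by (intro cont) simp_all
  qed
  then show ?thesis
    by (rule continuous_on_eq) (simp add: det_def'[OF M])
qed

lemma continuous_on_lin_det:
  assumes "linear_family S F"
  shows "continuous_on S (\<lambda>p. lin_det (F p))"
  unfolding lin_det_def
  by (rule continuous_on_det[OF mat_of_lin_carrier])
    (auto simp: mat_of_lin_def intro!: continuous_intros linear_familyD(2)[OF assms])

lemma continuous_on_char_poly:
  fixes F :: "'p::topological_space \<Rightarrow> 'a::euclidean_space \<Rightarrow> 'a"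
  assumes F: "linear_family S F" and z: "continuous_on S z"
  shows "continuous_on S (\<lambda>p. poly (lin_char_poly (F p)) (z p))"
  unfolding lin_char_poly_eq char_poly_matrix[OF complex_mat_carrier]
proof (rule continuous_on_det[where n="DIM('a)"])
  fix i j assume "i < DIM('a)" "j < DIM('a)"
  then show "continuous_on S (\<lambda>p. (- char_matrix (complex_mat (F p)) (z p)) $$ (i, j))"
    by (auto simp: char_matrix_def complex_mat_def mat_of_lin_def
        intro!: continuous_intros linear_familyD(2)[OF F] z)
qed (simp add: char_matrix_def complex_mat_def mat_of_lin_def)

lemma lin_det_id: "lin_det (\<lambda>x::'a::euclidean_space. x) = 1"
proof -
  have "mat_of_lin (\<lambda>x::'a. x) = 1\<^sub>m DIM('a)"
    by (rule eq_matI) (auto simp: mat_of_lin_def basis_list_inner)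
  then show ?thesis by (simp add: lin_det_def)
qed

lemma lin_det_uminus: "lin_det (\<lambda>x. - T x :: 'a::euclidean_space) = (-1) ^ DIM('a) * lin_det T"
proof -
  have "mat_of_lin (\<lambda>x. - T x) = (-1) \<cdot>\<^sub>m mat_of_lin T"
    by (rule eq_matI) (auto simp: mat_of_lin_def)
  then show ?thesis by (simp add: lin_det_def mat_of_lin_def)
qed

text \<open>
  The real form of \<open>T (x + \<i> y) = z (x + \<i> y)\<close> with \<open>x + \<i> y \<noteq> 0\<close>. It allows complex eigenvalues
  to be handled without complexifying the space.
\<close>

definition eigenpair :: "('a::real_vector \<Rightarrow> 'a) \<Rightarrow> complex \<Rightarrow> 'a \<Rightarrow> 'a \<Rightarrow> bool" where
  "eigenpair T z x y \<longleftrightarrow> (x \<noteq> 0 \<or> y \<noteq> 0) \<and>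
     T x = Re z *\<^sub>R x - Im z *\<^sub>R y \<and> T y = Im z *\<^sub>R x + Re z *\<^sub>R y"

lemma complex_mat_mult_vec:
  fixes T :: "'a::euclidean_space \<Rightarrow> 'a"
  assumes T: "linear T" and i: "i < DIM('a)"
  shows "(complex_mat T *\<^sub>v Matrix.vec DIM('a) (\<lambda>j. Complex (x \<bullet> basis_list ! j) (y \<bullet> basis_list ! j))) $ i
    = Complex (T x \<bullet> basis_list ! i) (T y \<bullet> basis_list ! i)"
proof -
  let ?b = "\<lambda>i. (basis_list :: 'a list) ! i"
  have expand: "T u \<bullet> ?b i = (\<Sum>j<DIM('a). (u \<bullet> ?b j) * (T (?b j) \<bullet> ?b i))" for u
  proof -
    have "T u \<bullet> ?b i = (\<Sum>b\<in>Basis. (u \<bullet> b) * (T b \<bullet> ?b i))"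
      using arg_cong[OF linear_basis_expansion[OF T, of u], of "\<lambda>w. w \<bullet> ?b i"]
      by (simp add: inner_sum_left)
    also have "\<dots> = (\<Sum>j<DIM('a). (u \<bullet> ?b j) * (T (?b j) \<bullet> ?b i))"
      by (rule sum_basis_list[symmetric])
    finally show ?thesis .
  qed
  have "(complex_mat T *\<^sub>v Matrix.vec DIM('a) (\<lambda>j. Complex (x \<bullet> ?b j) (y \<bullet> ?b j))) $ i
    = (\<Sum>j<DIM('a). complex_of_real (T (?b j) \<bullet> ?b i) * Complex (x \<bullet> ?b j) (y \<bullet> ?b j))"
    using i by (simp add: complex_mat_def mat_of_lin_def scalar_prod_def lessThan_atLeast0)
  also have "\<dots> = Complex (T x \<bullet> ?b i) (T y \<bullet> ?b i)"
    by (simp add: complex_eq_iff expand[of x] expand[of y] mult.commute)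
  finally show ?thesis .
qed

lemma Spec_iff_eigenpair:
  fixes T :: "'a::euclidean_space \<Rightarrow> 'a"
  assumes T: "linear T"
  shows "z \<in> Spec T \<longleftrightarrow> (\<exists>x y. eigenpair T z x y)"
proof -
  let ?b = "\<lambda>i. (basis_list :: 'a list) ! i"
  define c where "c = (\<lambda>x y :: 'a. Matrix.vec DIM('a) (\<lambda>j. Complex (x \<bullet> ?b j) (y \<bullet> ?b j)))"
  have eqI: "u = w" if "\<And>i. i < DIM('a) \<Longrightarrow> u \<bullet> ?b i = w \<bullet> ?b i" for u w :: 'a
  proof (rule euclidean_eqI)
    fix b :: 'a assume "b \<in> Basis"
    then obtain i where "i < DIM('a)" "b = ?b i"
      using basis_list[where 'a='a] distinct_card[of "basis_list :: 'a list"]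
      by (metis in_set_conv_nth)
    with that show "u \<bullet> b = w \<bullet> b" by simp
  qed
  have c_onto: "\<exists>x y. w = c x y" if "w \<in> carrier_vec DIM('a)" for w
  proof (intro exI)
    have "(\<Sum>j<DIM('a). f j *\<^sub>R ?b j) \<bullet> ?b i = f i" if "i < DIM('a)" for f i
    proof -
      have "(\<Sum>j<DIM('a). f j *\<^sub>R ?b j) \<bullet> ?b i = (\<Sum>j<DIM('a). if j = i then f j else 0)"
        using that by (simp add: inner_sum_left basis_list_inner if_distrib cong: if_cong)
      then show ?thesis using that by simp
    qed
    then show "w = c (\<Sum>j<DIM('a). Re (w $ j) *\<^sub>R ?b j) (\<Sum>j<DIM('a). Im (w $ j) *\<^sub>R ?b j)"
      using that by (intro eq_vecI) (auto simp: c_def complex_eq_iff)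
  qed
  have c0: "c x y = 0\<^sub>v DIM('a) \<longleftrightarrow> x = 0 \<and> y = 0" for x y
    using eqI[of x 0] eqI[of y 0] by (auto simp: c_def vec_eq_iff complex_eq_iff)
  have "z \<in> Spec T \<longleftrightarrow> eigenvalue (complex_mat T) z"
    by (simp add: Spec_def lin_char_poly_eq eigenvalue_root_char_poly[OF complex_mat_carrier])
  also have "\<dots> \<longleftrightarrow> (\<exists>w\<in>carrier_vec DIM('a). w \<noteq> 0\<^sub>v DIM('a) \<and> complex_mat T *\<^sub>v w = z \<cdot>\<^sub>v w)"
    by (auto simp: eigenvalue_def eigenvector_def complex_mat_def mat_of_lin_def)
  also have "\<dots> \<longleftrightarrow> (\<exists>x y. (x \<noteq> 0 \<or> y \<noteq> 0) \<and> complex_mat T *\<^sub>v c x y = z \<cdot>\<^sub>v c x y)"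
  proof -
    have "c x y \<in> carrier_vec DIM('a)" for x y by (simp add: c_def)
    then show ?thesis using c_onto c0 by (smt (verit))
  qed
  also have "\<dots> \<longleftrightarrow> (\<exists>x y. eigenpair T z x y)"
  proof -
    have "complex_mat T *\<^sub>v c x y = z \<cdot>\<^sub>v c x y \<longleftrightarrow>
        T x = Re z *\<^sub>R x - Im z *\<^sub>R y \<and> T y = Im z *\<^sub>R x + Re z *\<^sub>R y" for x y
    proof -
      have "complex_mat T *\<^sub>v c x y = z \<cdot>\<^sub>v c x y \<longleftrightarrow>
        (\<forall>i<DIM('a). (complex_mat T *\<^sub>v c x y) $ i = (z \<cdot>\<^sub>v c x y) $ i)"
        by (simp add: vec_eq_iff) (simp add: c_def complex_mat_def mat_of_lin_def)
      also have "\<dots> \<longleftrightarrow> (\<forall>i<DIM('a). T x \<bullet> ?b i = (Re z *\<^sub>R x - Im z *\<^sub>R y) \<bullet> ?b i \<and>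
          T y \<bullet> ?b i = (Im z *\<^sub>R x + Re z *\<^sub>R y) \<bullet> ?b i)"
      proof (intro all_cong1 imp_cong refl)
        fix i assume i: "i < DIM('a)"
        have "(z \<cdot>\<^sub>v c x y) $ i = z * Complex (x \<bullet> ?b i) (y \<bullet> ?b i)"
          using i by (simp add: c_def)
        then show "(complex_mat T *\<^sub>v c x y) $ i = (z \<cdot>\<^sub>v c x y) $ i \<longleftrightarrow>
          T x \<bullet> ?b i = (Re z *\<^sub>R x - Im z *\<^sub>R y) \<bullet> ?b i \<and>
          T y \<bullet> ?b i = (Im z *\<^sub>R x + Re z *\<^sub>R y) \<bullet> ?b i"
          using complex_mat_mult_vec[OF T i, of x y]
          by (auto simp: c_def complex_eq_iff inner_diff_left inner_add_left)
      qed
      also have "\<dots> \<longleftrightarrow> T x = Re z *\<^sub>R x - Im z *\<^sub>R y \<and> T y = Im z *\<^sub>R x + Re z *\<^sub>R y"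
        using eqI[of "T x" "Re z *\<^sub>R x - Im z *\<^sub>R y"] eqI[of "T y" "Im z *\<^sub>R x + Re z *\<^sub>R y"] by auto
      finally show ?thesis .
    qed
    then show ?thesis by (simp add: eigenpair_def)
  qed
  finally show ?thesis .
qed

text \<open>
  By induction on the size: the derivative of the characteristic polynomial is the sum of the
  characteristic polynomials of the principal minors, and each diagonal entry survives in all
  minors but one.
\<close>

lemma coeff_char_poly_trace:
  fixes M :: "'c :: {idom, ring_char_0} mat"
  assumes "M \<in> carrier_mat (Suc n) (Suc n)"
  shows "Polynomial.coeff (char_poly M) n = - (\<Sum>i<Suc n. M $$ (i, i))"
  using assms
proof (induction n arbitrary: M)
  case 0
  then show ?case
    by (simp add: char_poly_defs det_single[simplified])
next
  case (Suc n)
  have *: "Polynomial.coeff (char_poly (mat_delete M i i)) n = M $$ (i, i) - (\<Sum>j<Suc (Suc n). M $$ (j, j))"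
    if i: "i < Suc (Suc n)" for i
  proof -
    have "(\<Sum>j<Suc n. mat_delete M i i $$ (j, j)) = (\<Sum>j\<in>{..<Suc (Suc n)} - {i}. M $$ (j, j))"
    proof (rule sum.reindex_bij_witness[of _ "\<lambda>j. if j < i then j else j - 1" "\<lambda>j. if j < i then j else Suc j"])
    qed (use i Suc.prems in \<open>auto simp: mat_delete_def\<close>)
    also have "\<dots> = (\<Sum>j<Suc (Suc n). M $$ (j, j)) - M $$ (i, i)"
      using i by (subst sum_diff1) auto
    finally show ?thesis
      using Suc.IH[of "mat_delete M i i"] Suc.prems by (simp add: mat_delete_carrier[of M "Suc (Suc n)" "Suc (Suc n)", simplified])
  qed
  have "of_nat (Suc n) * Polynomial.coeff (char_poly M) (Suc n) = Polynomial.coeff (pderiv (char_poly M)) n"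
    by (simp add: coeff_pderiv)
  also have "\<dots> = (\<Sum>i<Suc (Suc n). Polynomial.coeff (char_poly (mat_delete M i i)) n)"
    by (simp only: pderiv_char_poly[OF Suc.prems] Polynomial.coeff_sum)
  also have "\<dots> = (\<Sum>i<Suc (Suc n). M $$ (i, i) - (\<Sum>j<Suc (Suc n). M $$ (j, j)))"
    by (intro sum.cong refl *) simp
  also have "\<dots> = of_nat (Suc n) * - (\<Sum>i<Suc (Suc n). M $$ (i, i))"
    by (simp only: sum_subtractf sum_constant card_lessThan) (simp add: algebra_simps)
  finally show ?case
    by (simp only: mult_cancel_left of_nat_eq_0_iff) simp
qed

lemma linear_factors_coeffs:
  fixes as :: "'c :: comm_ring_1 list"
  shows "Polynomial.coeff (\<Prod>a\<leftarrow>as. [:- a, 1:]) (length as) = 1"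
    and "as \<noteq> [] \<Longrightarrow> Polynomial.coeff (\<Prod>a\<leftarrow>as. [:- a, 1:]) (length as - 1) = - sum_list as"
proof -
  have "Polynomial.coeff (\<Prod>a\<leftarrow>as. [:- a, 1:]) (length as) = 1 \<and>
    (as \<noteq> [] \<longrightarrow> Polynomial.coeff (\<Prod>a\<leftarrow>as. [:- a, 1:]) (length as - 1) = - sum_list as) \<and>
    (\<forall>k>length as. Polynomial.coeff (\<Prod>a\<leftarrow>as. [:- a, 1:]) k = 0)"
    by (induction as) (auto simp: coeff_pCons split: nat.splits)
  then show "Polynomial.coeff (\<Prod>a\<leftarrow>as. [:- a, 1:]) (length as) = 1"
    and "as \<noteq> [] \<Longrightarrow> Polynomial.coeff (\<Prod>a\<leftarrow>as. [:- a, 1:]) (length as - 1) = - sum_list as"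
    by auto
qed

text \<open>
  The eigenvalues listed with their algebraic multiplicities; comparing the coefficients below the
  leading one shows that they add up to the trace.
\<close>

lemma eigenvalue_list:
  fixes T :: "'a::euclidean_space \<Rightarrow> 'a"
  obtains as where "lin_char_poly T = (\<Prod>a\<leftarrow>as. [:- a, 1:])" "length as = DIM('a)"
    "set as = Spec T" "complex_of_real (lin_trace T) = sum_list as"
proof -
  obtain as where as: "lin_char_poly T = (\<Prod>a\<leftarrow>as. [:- a, 1:])" "length as = DIM('a)"
    using char_poly_factorized[OF complex_mat_carrier[of T]] lin_char_poly_eq by metis
  have "set as = Spec T"
    by (auto simp: Spec_def as(1) poly_prod_list prod_list_zero_iff)
  moreover have "complex_of_real (lin_trace T) = sum_list as"
  proof -
    obtain n where n: "DIM('a) = Suc n"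
      using DIM_positive[where 'a='a] by (metis gr0_implies_Suc)
    have "complex_of_real (lin_trace T) = (\<Sum>i<Suc n. complex_mat T $$ (i, i))"
      unfolding lin_trace_def sum_basis_list[symmetric, of "\<lambda>b. T b \<bullet> b"] n
      by (simp add: complex_mat_def mat_of_lin_def n)
    also have "\<dots> = - Polynomial.coeff (char_poly (complex_mat T)) n"
      using coeff_char_poly_trace[of "complex_mat T" n] complex_mat_carrier[of T] n by simp
    also have "\<dots> = sum_list as"
      using linear_factors_coeffs(2)[of as] as n unfolding lin_char_poly_eq by force
    finally show ?thesis .
  qed
  ultimately show ?thesis using that as by blast
qed

lemma order_linear_factors: "Polynomial.order a (\<Prod>a\<leftarrow>as. [:- a, 1:]) = count_list as (a::complex)"
proof (induction as)
  case (Cons b as)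
  have "(\<Prod>a\<leftarrow>as. [:- a, 1:]) \<noteq> 0"
    by (auto simp: prod_list_zero_iff)
  moreover have "Polynomial.order a [:- b, 1:] = (if a = b then 1 else 0)"
    by (cases "a = b") (auto simp: order_0I order_linear_power[of _ _ 1, simplified])
  ultimately show ?case
    using Cons by (simp add: order_mult del: mult_pCons_left)
qed (simp add: order_0I)

lemma trace_of_nilpotent:
  assumes "Spec T \<subseteq> {0}"
  shows "lin_trace T = 0"
proof -
  obtain as where as: "set as = Spec T" "complex_of_real (lin_trace T) = sum_list as"
    by (rule eigenvalue_list)
  have "sum_list as = 0"
    using as(1) assms by (intro sum_list_neutral) auto
  with as show ?thesis by simp
qed

text \<open>
  With two eigenvalues, one of which is zero, the trace determines the multiplicities.
\<close>

lemma multiplicities_two_eigenvalues: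
  fixes T :: "'a::euclidean_space \<Rightarrow> 'a" and c :: real
  assumes "Spec T = {0, complex_of_real c}" "c \<noteq> 0"
  shows "lin_trace T = alg_mult T c * c" "alg_mult T 0 + alg_mult T c = DIM('a)"
proof -
  obtain as where as: "lin_char_poly T = (\<Prod>a\<leftarrow>as. [:- a, 1:])" "length as = DIM('a)"
      "set as = Spec T" "complex_of_real (lin_trace T) = sum_list as"
    by (rule eigenvalue_list)
  have mult: "alg_mult T z = count_list as z" for z
    by (simp add: alg_mult_def as(1) order_linear_factors)
  have "set as \<subseteq> {0, complex_of_real c} \<Longrightarrow>
      sum_list as = of_nat (count_list as c) * c \<and> count_list as 0 + count_list as c = length as"
    using assms(2) by (induction as) (auto simp: algebra_simps)
  then have *: "sum_list as = of_nat (count_list as c) * c" "count_list as 0 + count_list as c = length as"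
    using as(3) assms(1) by auto
  show "alg_mult T 0 + alg_mult T c = DIM('a)"
    using * as by (simp add: mult)
  have "complex_of_real (lin_trace T) = complex_of_real (alg_mult T c * c)"
    using * as by (simp add: mult)
  then show "lin_trace T = alg_mult T c * c"
    by (simp only: of_real_eq_iff)
qed

text \<open>
  The modulus of the characteristic polynomial is the product of the distances to the eigenvalues,
  so at a point far from all of them it cannot be small. Applied to nearby operators, this is the lower
  semicontinuity of the spectrum.
\<close>

lemma near_eigenvalue:
  fixes T :: "'a::euclidean_space \<Rightarrow> 'a"
  assumes "norm (poly (lin_char_poly T) z) < \<epsilon> ^ DIM('a)" and "\<epsilon> > 0"
  shows "\<exists>w\<in>Spec T. norm (z - w) < \<epsilon>"
proof (rule ccontr)
  assume far: "\<not> ?thesis"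
  obtain as where as: "lin_char_poly T = (\<Prod>a\<leftarrow>as. [:- a, 1:])" "length as = DIM('a)" "set as = Spec T"
    by (rule eigenvalue_list)
  have "(\<forall>a\<in>set as. \<epsilon> \<le> norm (z - a)) \<Longrightarrow> \<epsilon> ^ length as \<le> norm (poly (\<Prod>a\<leftarrow>as. [:- a, 1:]) z)"
    using assms(2)
    by (induction as) (auto simp: norm_mult left_diff_distrib[symmetric] simp del: mult_pCons_left intro!: mult_mono)
  with as far assms(1) show False
    by (auto simp: not_less)
qed

lemma zero_in_Spec_iff:
  assumes "linear T"
  shows "0 \<in> Spec T \<longleftrightarrow> (\<exists>x. x \<noteq> 0 \<and> T x = 0)"
  using assms by (auto simp: Spec_iff_eigenpair eigenpair_def)

lemma lin_det_eq_0_iff: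
  assumes "linear T"
  shows "lin_det T = 0 \<longleftrightarrow> (\<exists>x. x \<noteq> 0 \<and> T x = 0)"
proof -
  have "poly (lin_char_poly T) 0 = complex_of_real (lin_det (\<lambda>x. - T x))"
  proof -
    have "- char_matrix (complex_mat T) 0 = complex_mat (\<lambda>x. - T x)"
      by (rule eq_matI) (auto simp: char_matrix_def complex_mat_def mat_of_lin_def)
    then show ?thesis
      unfolding lin_char_poly_eq char_poly_matrix[OF complex_mat_carrier] lin_det_def
      by (simp add: complex_mat_def of_real_hom.hom_det)
  qed
  then have "0 \<in> Spec T \<longleftrightarrow> lin_det T = 0"
    by (simp add: Spec_def lin_det_uminus)
  with zero_in_Spec_iff[OF assms] show ?thesis by simp
qed

section \<open>The hairy ball theorem\<close>

lemma nsphere_coordinate_swap: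
  assumes "k \<le> n"
  shows "continuous_map (nsphere n) (nsphere n) (\<lambda>x i. x (Transposition.transpose 0 k i))"
proof -
  have perm: "(\<Sum>i\<le>n. (x (Transposition.transpose 0 k i))\<^sup>2) = (\<Sum>i\<le>n. (x i)\<^sup>2)" for x :: "nat \<Rightarrow> real"
  proof (rule sum.reindex_bij_betw[of "Transposition.transpose 0 k" "{..n}" "{..n}" "\<lambda>i. (x i)\<^sup>2"])
    show "bij_betw (Transposition.transpose 0 k) {..n} {..n}"
      using assms by (intro bij_betwI[of _ _ _ "Transposition.transpose 0 k"]) (auto simp: Transposition.transpose_def)
  qed
  show ?thesis
    unfolding nsphere continuous_map_in_subtopology continuous_map_componentwise_UNIV
    using assms
    by (auto simp: perm intro!: continuous_map_from_subtopology continuous_map_product_projection)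
qed

text \<open>
  All coordinate reflections are conjugate to the first one, and conjugation by a swap does not
  change the degree, as the swap is an involution and so has degree \<open>1\<close> or \<open>-1\<close>.
\<close>

lemma Brouwer_degree2_coordinate_reflection:
  assumes "k \<le> n"
  shows "Brouwer_degree2 n (\<lambda>x i. if i = k then - x i else x i) = -1"
proof -
  define s where "s = (\<lambda>(x :: nat \<Rightarrow> real) i. x (Transposition.transpose 0 k i))"
  define r where "r = (\<lambda>(x :: nat \<Rightarrow> real) i. if i = 0 then - x i else x i)"
  have s: "continuous_map (nsphere n) (nsphere n) s"
    unfolding s_def by (rule nsphere_coordinate_swap[OF assms])
  have r: "continuous_map (nsphere n) (nsphere n) r"
    unfolding r_def by (rule continuous_map_nsphere_reflection)
  have ss: "s \<circ> s = id"
    by (auto simp: s_def fun_eq_iff)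
  have "(\<lambda>x i. if i = k then - x i else x i) = s \<circ> (r \<circ> s)"
    by (auto simp: s_def r_def fun_eq_iff Transposition.transpose_def)
  then have "Brouwer_degree2 n (\<lambda>x i. if i = k then - x i else x i)
      = Brouwer_degree2 n s * (Brouwer_degree2 n r * Brouwer_degree2 n s)"
    using s r by (simp add: Brouwer_degree2_compose continuous_map_compose)
  moreover have "Brouwer_degree2 n s * Brouwer_degree2 n s = 1"
    using Brouwer_degree2_compose[OF s s] ss by simp
  moreover have "Brouwer_degree2 n r = -1"
    unfolding r_def by (rule Brouwer_degree2_reflection)
  ultimately show ?thesis by simp
qed

lemma Brouwer_degree2_antipodal: "Brouwer_degree2 n (\<lambda>x i. - x i) = (-1) ^ Suc n"
proof -
  define f where "f = (\<lambda>j (x :: nat \<Rightarrow> real) i. if i < j then - x i else x i)"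
  have step: "f (Suc j) = (\<lambda>x i. if i = j then - x i else x i) \<circ> f j" for j
    by (auto simp: f_def fun_eq_iff)
  have "continuous_map (nsphere n) (nsphere n) (f j) \<and> Brouwer_degree2 n (f j) = (-1) ^ j"
    if "j \<le> Suc n" for j
    using that
  proof (induction j)
    case 0
    have "f 0 = id" by (auto simp: f_def)
    then show ?case by (simp del: id_apply add: Brouwer_degree2_id[unfolded id_def])
  next
    case (Suc j)
    define r where "r = (\<lambda>(x :: nat \<Rightarrow> real) i. if i = j then - x i else x i)"
    have r: "continuous_map (nsphere n) (nsphere n) r"
      unfolding r_def by (rule continuous_map_nsphere_reflection)
    have "Brouwer_degree2 n r = -1"
      unfolding r_def using Suc.prems by (intro Brouwer_degree2_coordinate_reflection) simp
    moreover have "continuous_map (nsphere n) (nsphere n) (f j)" "Brouwer_degree2 n (f j) = (-1) ^ j"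
      using Suc by simp_all
    moreover have "f (Suc j) = r \<circ> f j"
      unfolding r_def by (rule step)
    ultimately show ?case
      using r Brouwer_degree2_compose[of n "f j" r] continuous_map_compose[of _ _ "f j" _ r]
      by (metis power_Suc)
  qed
  from this[of "Suc n"] have "Brouwer_degree2 n (f (Suc n)) = (-1) ^ Suc n"
    by simp
  moreover have "Brouwer_degree2 n (f (Suc n)) = Brouwer_degree2 n (\<lambda>x i. - x i)"
    by (rule Brouwer_degree2_eq) (auto simp: f_def nsphere fun_eq_iff)
  ultimately show ?thesis by simp
qed

text \<open>
  A nowhere vanishing tangent field \<open>Z\<close> gives a homotopy from the identity to the antipodal map:
  move every \<open>v\<close> along the half great circle in the direction of \<open>Z v\<close>. In odd dimension the
  antipodal map has degree \<open>-1\<close>. The sphere of \<open>V\<close> is compared with the model sphere in coordinates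
  by means of an orthonormal basis.
\<close>

theorem hairy_ball:
  fixes Z :: "'a::euclidean_space \<Rightarrow> 'a"
  assumes odd: "odd DIM('a)"
    and cont: "continuous_on (sphere 0 1) Z"
    and tangent: "\<And>v. norm v = 1 \<Longrightarrow> Z v \<bullet> v = 0"
    and nonzero: "\<And>v. norm v = 1 \<Longrightarrow> Z v \<noteq> 0"
  shows False
proof -
  define n where "n = DIM('a) - 1"
  have m: "DIM('a) = Suc n" by (simp add: n_def)
  have mS: "{..n} = {..<DIM('a)}" using m by auto
  let ?b = "\<lambda>i. (basis_list :: 'a list) ! i"
  define \<phi> where "\<phi> = (\<lambda>x :: nat \<Rightarrow> real. \<Sum>i\<le>n. x i *\<^sub>R ?b i)"
  define \<psi> where "\<psi> = (\<lambda>(u::'a) i. if i \<le> n then u \<bullet> ?b i else 0)"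
  have \<phi>b: "\<phi> x \<bullet> ?b j = x j" if "j \<le> n" for x j
  proof -
    have "\<phi> x \<bullet> ?b j = (\<Sum>i\<le>n. x i * (?b i \<bullet> ?b j))"
      by (simp add: \<phi>_def inner_sum_left)
    also have "\<dots> = (\<Sum>i\<le>n. if i = j then x i else 0)"
      using that m by (intro sum.cong refl) (simp add: basis_list_inner)
    finally show ?thesis using that by simp
  qed
  have norm\<psi>: "(\<Sum>i\<le>n. (\<psi> u i)\<^sup>2) = (norm u)\<^sup>2" for u
  proof -
    have "(\<Sum>i\<le>n. (\<psi> u i)\<^sup>2) = (\<Sum>i<DIM('a). (u \<bullet> ?b i)\<^sup>2)"
      unfolding mS[symmetric] by (simp add: \<psi>_def)
    also have "\<dots> = (\<Sum>b\<in>Basis. (u \<bullet> b)\<^sup>2)"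
      by (rule sum_basis_list)
    finally show ?thesis
      by (simp add: norm_eq_sqrt_inner euclidean_inner[of u u] power2_eq_square sum_nonneg)
  qed
  have \<psi>\<phi>: "\<psi> (\<phi> x) = x" if "x \<in> topspace (nsphere n)" for x
    using that by (auto simp: \<psi>_def \<phi>b nsphere fun_eq_iff)
  have norm\<phi>: "norm (\<phi> x) = 1" if "x \<in> topspace (nsphere n)" for x
  proof -
    have "(norm (\<phi> x))\<^sup>2 = 1"
      using that norm\<psi>[of "\<phi> x"] by (simp add: \<psi>\<phi>) (simp add: nsphere)
    then show ?thesis
      by (metis norm_ge_zero power2_eq_1_iff not_numeral_less_zero zero_le_numeral norm_minus_cancel le_minus_one_simps(3))
  qed
  have cont\<phi>: "continuous_map (nsphere n) (top_of_set (sphere 0 1)) \<phi>"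
  proof -
    have "continuous_map (nsphere n) euclidean \<phi>"
      unfolding \<phi>_def
    proof (intro continuous_map_sum)
      fix i
      have "continuous_map euclideanreal euclidean (\<lambda>r. r *\<^sub>R ?b i)"
        by (auto intro!: continuous_intros)
      from continuous_map_compose[OF continuous_map_nsphere_projection this]
      show "continuous_map (nsphere n) euclidean (\<lambda>x. x i *\<^sub>R ?b i)"
        by (simp add: o_def)
    qed simp
    then show ?thesis
      using norm\<phi> by (auto simp: continuous_map_in_subtopology)
  qed
  have cont\<psi>: "continuous_map X (nsphere n) (\<lambda>p. \<psi> (g p))"
    if g: "continuous_map X euclidean g" and g1: "\<And>p. p \<in> topspace X \<Longrightarrow> norm (g p) = 1"
    for X :: "'b topology" and g
  proof -
    have "continuous_map X euclideanreal (\<lambda>p. \<psi> (g p) i)" for i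
    proof (cases "i \<le> n")
      case True
      have "continuous_map euclidean euclideanreal (\<lambda>u::'a. u \<bullet> ?b i)"
        by (auto intro!: continuous_intros)
      from continuous_map_compose[OF g this] True show ?thesis
        by (simp add: \<psi>_def o_def)
    qed (simp add: \<psi>_def)
    then show ?thesis
      unfolding nsphere continuous_map_in_subtopology continuous_map_componentwise_UNIV
      using g1 norm\<psi> by (auto simp: \<psi>_def)
  qed
  \<comment> \<open>The half great circle from \<open>v\<close> through \<open>Z v / norm (Z v)\<close> to \<open>-v\<close>.\<close>
  define h where "h = (\<lambda>(t, v). cos (pi * t) *\<^sub>R v + sin (pi * t) *\<^sub>R (Z v /\<^sub>R norm (Z v)))"
  have norm_h: "norm (h (t, v)) = 1" if v: "norm v = 1" for t v
  proof -
    define u where "u = Z v /\<^sub>R norm (Z v)"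
    have "v \<bullet> v = 1" "u \<bullet> u = 1" "u \<bullet> v = 0" "v \<bullet> u = 0"
      using tangent[OF v] nonzero[OF v] v
      by (simp_all add: u_def inner_commute[of v] norm_eq_1[symmetric] dot_square_norm power2_eq_square)
    then have "(norm (h (t, v)))\<^sup>2 = 1"
      unfolding power2_norm_eq_inner h_def prod.case u_def[symmetric]
      by (simp add: inner_add_left inner_add_right power2_eq_square[symmetric])
    then show ?thesis
      by (metis norm_ge_zero power2_eq_1_iff le_minus_one_simps(3))
  qed
  have cont_h: "continuous_map (top_of_set ({0..1} \<times> sphere 0 1)) euclidean h"
  proof -
    have Z2: "continuous_on ({0..1::real} \<times> sphere 0 1) (\<lambda>p. Z (snd p))"
      by (rule continuous_on_compose2[OF cont]) (auto intro!: continuous_intros)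
    show ?thesis
      unfolding h_def case_prod_beta continuous_map_iff_continuous
      using nonzero by (intro continuous_intros Z2) auto
  qed
  have 1: "continuous_map (prod_topology (top_of_set {0..1::real}) (nsphere n)) (top_of_set ({0..1} \<times> sphere 0 1))
            (\<lambda>p. (fst p, \<phi> (snd p)))"
  proof -
    have "continuous_map (prod_topology (top_of_set {0..1}) (nsphere n))
        (prod_topology (top_of_set {0..1::real}) (top_of_set (sphere 0 1))) (\<lambda>p. (fst p, \<phi> (snd p)))"
      unfolding continuous_map_pairwise o_def fst_conv snd_conv
      using continuous_map_compose[OF continuous_map_snd cont\<phi>]
      by (auto simp: o_def continuous_map_fst)
    then show ?thesis
      by (simp only: prod_topology_subtopology_eu)
  qed
  have "homotopic_with (\<lambda>x. True) (nsphere n) (nsphere n) id (\<lambda>x i. - x i)"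
  proof (subst homotopic_with, simp, intro exI conjI ballI)
    let ?H = "\<lambda>p. \<psi> (h (fst p, \<phi> (snd p)))"
    have ph: "p \<in> topspace (prod_topology (top_of_set {0..1::real}) (nsphere n)) \<Longrightarrow> norm (h (fst p, \<phi> (snd p))) = 1" for p
      using norm_h norm\<phi> by auto
    show "continuous_map (prod_topology (top_of_set {0..1}) (nsphere n)) (nsphere n) ?H"
      using cont\<psi>[OF continuous_map_compose[OF 1 cont_h, unfolded o_def] ph] by simp
    fix x assume x: "x \<in> topspace (nsphere n)"
    show "?H (0, x) = id x"
      using \<psi>\<phi>[OF x] by (simp add: h_def)
    show "?H (1, x) = (\<lambda>i. - x i)"
      using \<psi>\<phi>[OF x] by (simp add: h_def \<psi>_def fun_eq_iff) (metis minus_zero)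
  qed simp
  then have "Brouwer_degree2 n id = Brouwer_degree2 n (\<lambda>x i. - x i)"
    by (rule Brouwer_degree2_homotopic)
  moreover have "even n" using odd m by simp
  ultimately show False
    by (simp add: Brouwer_degree2_antipodal)
qed

section \<open>Polynomials of an operator\<close>

definition poly_op :: "real poly \<Rightarrow> ('a::real_vector \<Rightarrow> 'a) \<Rightarrow> 'a \<Rightarrow> 'a" where
  "poly_op p T x = (\<Sum>i\<le>Polynomial.degree p. Polynomial.coeff p i *\<^sub>R (T ^^ i) x)"

lemma poly_op_bound:
  assumes "Polynomial.degree p \<le> n"
  shows "poly_op p T x = (\<Sum>i\<le>n. Polynomial.coeff p i *\<^sub>R (T ^^ i) x)"
  unfolding poly_op_def using assms
  by (intro sum.mono_neutral_left) (auto simp: coeff_eq_0)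

lemma linear_funpow: "linear T \<Longrightarrow> linear (T ^^ n)" for T :: "'a::real_vector \<Rightarrow> 'a"
  by (induction n) (auto intro: linear_compose simp: linear_id)

lemma linear_poly_op: "linear T \<Longrightarrow> linear (poly_op p T)"
  unfolding poly_op_def
  by (intro linear_compose_sum ballI linear_compose_scale_right linear_funpow)

lemma poly_op_0 [simp]: "poly_op 0 T x = 0"
  by (simp add: poly_op_def)

lemma poly_op_1 [simp]: "poly_op 1 T x = x"
  by (simp add: poly_op_def)

lemma poly_op_add: "poly_op (p + q) T x = poly_op p T x + poly_op q T x"
proof -
  define n where "n = max (Polynomial.degree p) (Polynomial.degree q)"
  have "Polynomial.degree p \<le> n" "Polynomial.degree q \<le> n" "Polynomial.degree (p + q) \<le> n"
    by (auto simp: n_def degree_add_le_max)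
  then show ?thesis
    by (simp add: poly_op_bound[of _ n] scaleR_add_left sum.distrib)
qed

lemma poly_op_smult: "poly_op (Polynomial.smult c p) T x = c *\<^sub>R poly_op p T x"
  by (simp add: poly_op_bound[OF degree_smult_le] scaleR_sum_right) (simp add: poly_op_def scaleR_sum_right)

lemma poly_op_diff: "poly_op (p - q) T x = poly_op p T x - poly_op q T x"
  using poly_op_add[of "p - q" q T x] by simp

lemma poly_op_pCons:
  assumes "linear T"
  shows "poly_op (pCons a p) T x = a *\<^sub>R x + T (poly_op p T x)"
proof -
  have "poly_op (pCons a p) T x = (\<Sum>i\<le>Suc (Polynomial.degree p). Polynomial.coeff (pCons a p) i *\<^sub>R (T ^^ i) x)"
    by (rule poly_op_bound[OF degree_pCons_le])
  also have "\<dots> = a *\<^sub>R x + (\<Sum>i\<le>Polynomial.degree p. Polynomial.coeff p i *\<^sub>R T ((T ^^ i) x))"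
    by (subst sum.atMost_Suc_shift) simp
  also have "\<dots> = a *\<^sub>R x + T (poly_op p T x)"
    by (simp add: poly_op_def linear_sum[OF assms] linear_scale[OF assms])
  finally show ?thesis .
qed

lemma poly_op_mult:
  assumes "linear T"
  shows "poly_op (p * q) T x = poly_op p T (poly_op q T x)"
proof (induction p)
  case (pCons a p)
  then show ?case
    by (simp add: poly_op_pCons[OF assms] poly_op_add poly_op_smult)
qed simp

lemma poly_op_commute: "linear T \<Longrightarrow> poly_op p T (poly_op q T x) = poly_op q T (poly_op p T x)"
  by (metis poly_op_mult mult.commute)

lemma poly_op_zero_arg: "linear T \<Longrightarrow> poly_op p T 0 = 0"
  by (simp add: linear_0 linear_poly_op)

lemma poly_op_dvd:
  assumes "linear T" "p dvd q" "poly_op p T x = 0"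
  shows "poly_op q T x = 0"
proof -
  obtain r where "q = r * p" using assms(2) by (auto simp: dvd_def mult.commute)
  then show ?thesis using assms by (simp add: poly_op_mult poly_op_zero_arg)
qed

lemma poly_op_kernel:
  assumes T: "linear T" and "T x = 0"
  shows "poly_op p T x = poly p 0 *\<^sub>R x"
  by (induction p) (simp_all add: poly_op_pCons[OF T] linear_scale[OF T] assms)

lemma linear_family_funpow: "linear_family S F \<Longrightarrow> linear_family S (\<lambda>p. F p ^^ n)"
proof (induction n)
  case 0
  then show ?case by (simp add: linear_family_id id_def)
next
  case (Suc n)
  show ?case
    using linear_family_compose[OF Suc.prems Suc.IH[OF Suc.prems]] by (simp add: o_def)
qed

lemma linear_family_poly_op:
  assumes "linear_family S F"
  shows "linear_family S (\<lambda>p. poly_op q (F p))"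
  using linear_familyD(1)[OF assms] linear_familyD(2)[OF linear_family_funpow[OF assms]]
  unfolding linear_family_def
  by (auto simp: linear_poly_op poly_op_def intro!: continuous_intros)

text \<open>
  The polynomial \<open>(X - z) (X - cnj z)\<close>. It is used for real \<open>z\<close> as well, where it is the square of
  the linear factor; this costs nothing and avoids a case distinction.
\<close>

definition conj_quadratic :: "complex \<Rightarrow> real poly" where
  "conj_quadratic z = [:(Re z)\<^sup>2 + (Im z)\<^sup>2, - 2 * Re z, 1:]"

lemma poly_conj_quadratic:
  "poly (map_poly complex_of_real (conj_quadratic z)) w = (w - z) * (w - cnj z)"
  unfolding conj_quadratic_def
  by (simp add: complex_eq_iff algebra_simps power2_eq_square)

lemma conj_quadratic_nonzero [simp]: "conj_quadratic z \<noteq> 0"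
  by (simp add: conj_quadratic_def)

lemma degree_conj_quadratic: "Polynomial.degree (conj_quadratic z) = 2"
  by (simp add: conj_quadratic_def)

lemma poly_op_conj_quadratic:
  "linear T \<Longrightarrow> poly_op (conj_quadratic z) T x = T (T x) - Re z *\<^sub>R T x - Re z *\<^sub>R T x + ((Re z)\<^sup>2 + (Im z)\<^sup>2) *\<^sub>R x"
  using scaleR_add_left[of "Re z" "Re z" "T x"]
  by (simp add: conj_quadratic_def poly_op_pCons linear_add linear_scale linear_diff linear_neg linear_0 algebra_simps)

lemma conj_quadratic_eigenpair:
  assumes T: "linear T" and e: "eigenpair T z x y"
  shows "poly_op (conj_quadratic z) T x = 0" "poly_op (conj_quadratic z) T y = 0"
proof -
  have Tx: "T x = Re z *\<^sub>R x - Im z *\<^sub>R y" and Ty: "T y = Im z *\<^sub>R x + Re z *\<^sub>R y"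
    using e by (auto simp: eigenpair_def)
  show "poly_op (conj_quadratic z) T x = 0" "poly_op (conj_quadratic z) T y = 0"
    unfolding poly_op_conj_quadratic[OF T]
    by (simp_all add: Tx Ty linear_add[OF T] linear_diff[OF T] linear_scale[OF T]
        algebra_simps power2_eq_square)
qed

text \<open>
  If \<open>z\<close> is not real, \<open>x\<close> and \<open>(Re z x - T x) / Im z\<close> are the real and imaginary part of an
  eigenvector. If it is real, then \<open>(T - z)\<^sup>2 x = 0\<close>, and \<open>x\<close> or \<open>(T - z) x\<close> is an eigenvector.
\<close>

lemma eigenvalue_of_conj_quadratic_kernel:
  fixes T :: "'a::euclidean_space \<Rightarrow> 'a"
  assumes T: "linear T" and x: "x \<noteq> 0" "poly_op (conj_quadratic z) T x = 0"
  shows "z \<in> Spec T"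
proof (cases "Im z = 0")
  case False
  define y where "y = (1 / Im z) *\<^sub>R (Re z *\<^sub>R x - T x)"
  have Tx: "T x = Re z *\<^sub>R x - Im z *\<^sub>R y"
    using False by (simp add: y_def)
  have TT: "T (T x) = Re z *\<^sub>R T x + Re z *\<^sub>R T x - ((Re z)\<^sup>2 + (Im z)\<^sup>2) *\<^sub>R x"
    using x(2) by (simp add: poly_op_conj_quadratic[OF T] algebra_simps)
  have "Im z *\<^sub>R T y = Im z *\<^sub>R (Im z *\<^sub>R x + Re z *\<^sub>R y)"
  proof -
    have "Im z *\<^sub>R T y = Re z *\<^sub>R T x - T (T x)"
      using False by (simp add: y_def linear_scale[OF T] linear_diff[OF T])
    also have "\<dots> = Im z *\<^sub>R (Im z *\<^sub>R x + Re z *\<^sub>R y)"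
      using False unfolding TT y_def by (simp add: algebra_simps power2_eq_square)
    finally show ?thesis .
  qed
  then have "eigenpair T z x y"
    using False x(1) Tx by (simp add: eigenpair_def)
  then show ?thesis using Spec_iff_eigenpair[OF T] by blast
next
  case True
  define y where "y = T x - Re z *\<^sub>R x"
  have "T y = Re z *\<^sub>R y"
    using x(2) True
    by (simp add: y_def poly_op_conj_quadratic[OF T] linear_diff[OF T] linear_scale[OF T]
        algebra_simps power2_eq_square)
  then have "eigenpair T z x x \<or> eigenpair T z y y"
    using True x(1) by (auto simp: eigenpair_def y_def)
  then show ?thesis using Spec_iff_eigenpair[OF T] by blast
qed

lemma conj_quadratic_dvd:
  fixes p :: "real poly"
  assumes root: "poly (map_poly complex_of_real p) z = 0" and "Im z \<noteq> 0"
  shows "conj_quadratic z dvd p"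
proof -
  interpret hp: map_poly_comm_ring_hom complex_of_real ..
  define r where "r = p mod conj_quadratic z"
  have "poly (map_poly complex_of_real r) z = 0"
  proof -
    have "map_poly complex_of_real p =
      map_poly complex_of_real (p div conj_quadratic z) * map_poly complex_of_real (conj_quadratic z)
      + map_poly complex_of_real r"
      unfolding r_def hp.hom_mult[symmetric] hp.hom_add[symmetric] by simp
    then show ?thesis using root by (simp add: poly_conj_quadratic)
  qed
  moreover have "Polynomial.degree r < 2"
    unfolding r_def using degree_mod_less'[of "conj_quadratic z" p] degree_conj_quadratic[of z]
    by (cases "p mod conj_quadratic z = 0") auto
  then obtain a b where "r = [:a, b:]"
  proof -
    assume deg: "Polynomial.degree r < 2"
    obtain a r' where r': "r = pCons a r'" by (cases r)
    then have "Polynomial.degree r' = 0" using deg by (auto simp: degree_pCons_eq_if split: if_splits)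
    then obtain b where "r' = [:b:]" by (meson degree_eq_zeroE)
    with r' that show thesis by simp
  qed
  ultimately have "a = 0 \<and> b = 0"
    using \<open>Im z \<noteq> 0\<close> by (auto simp: complex_eq_iff of_real_hom.map_poly_pCons_hom)
  then show ?thesis
    using \<open>r = [:a, b:]\<close> by (simp add: r_def mod_eq_0_iff_dvd)
qed

text \<open>
  The vectors \<open>x, T x, \<dots>, T\<^sup>m x\<close> are too many to be independent.
\<close>

lemma vector_annihilator:
  fixes T :: "'a::euclidean_space \<Rightarrow> 'a"
  obtains p where "p \<noteq> 0" "Polynomial.degree p \<le> DIM('a)" "poly_op p T x = 0"
proof (cases "inj_on (\<lambda>i. (T ^^ i) x) {..DIM('a)}")
  case False
  then obtain i j where ij: "i \<le> DIM('a)" "j \<le> DIM('a)" "i \<noteq> j" "(T ^^ i) x = (T ^^ j) x"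
    by (auto simp: inj_on_def)
  define p :: "real poly" where "p = Polynomial.monom 1 i - Polynomial.monom 1 j"
  have "Polynomial.degree p \<le> DIM('a)"
    unfolding p_def using ij by (intro degree_diff_le) (simp_all add: degree_monom_eq)
  moreover have "Polynomial.coeff p i = 1"
    using ij by (simp add: p_def)
  then have "p \<noteq> 0" by auto
  moreover have "poly_op (Polynomial.monom 1 k) T x = (T ^^ k) x" for k
  proof -
    have "poly_op (Polynomial.monom 1 k) T x = (\<Sum>i\<le>k. (if i = k then 1 else 0) *\<^sub>R (T ^^ i) x)"
      by (auto simp: poly_op_def degree_monom_eq intro!: sum.cong)
    also have "\<dots> = (\<Sum>i\<le>k. if i = k then (T ^^ i) x else 0)"
      by (intro sum.cong) auto
    finally show ?thesis by simp
  qed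
  then have "poly_op p T x = 0"
    using ij by (simp add: p_def poly_op_diff)
  ultimately show ?thesis using that by blast
next
  case True
  let ?W = "(\<lambda>i. (T ^^ i) x) ` {..DIM('a)}"
  have "card ?W > DIM('a)"
    using card_image[OF True] by simp
  then have "dependent ?W"
    by (intro dependent_biggerset) auto
  then obtain u where u: "(\<Sum>w\<in>?W. u w *\<^sub>R w) = 0" "\<exists>w\<in>?W. u w \<noteq> 0"
    using dependent_finite[of ?W] by auto
  define p where "p = (\<Sum>i\<le>DIM('a). Polynomial.monom (u ((T ^^ i) x)) i)"
  have coeff: "Polynomial.coeff p i = u ((T ^^ i) x)" if "i \<le> DIM('a)" for i
    using that by (simp add: p_def Polynomial.coeff_sum)
  have deg: "Polynomial.degree p \<le> DIM('a)"
    unfolding p_def by (intro degree_sum_le) (auto intro: order.trans[OF degree_monom_le])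
  moreover have "p \<noteq> 0"
    using u(2) coeff by auto
  moreover have "poly_op p T x = 0"
    using u(1) by (simp add: poly_op_bound[OF deg] coeff sum.reindex[OF True])
  ultimately show ?thesis using that by blast
qed

text \<open>
  Split off from \<open>p\<close> the real factor belonging to a complex root. If the root is in \<open>\<Sigma>\<close>, the factor
  divides the product; otherwise it acts injectively and can be dropped.
\<close>

lemma annihilator_from_spectrum_aux:
  fixes T :: "'a::euclidean_space \<Rightarrow> 'a"
  assumes T: "linear T" and fin: "finite \<Sigma>" and spec: "Spec T \<subseteq> \<Sigma>"
  shows "p \<noteq> 0 \<Longrightarrow> poly_op p T x = 0 \<Longrightarrow>
    poly_op ((\<Prod>z\<in>\<Sigma>. conj_quadratic z) ^ Polynomial.degree p) T x = 0"
proof (induction "Polynomial.degree p" arbitrary: p x rule: less_induct)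
  case less
  let ?q = "\<Prod>z\<in>\<Sigma>. conj_quadratic z"
  show ?case
  proof (cases "Polynomial.degree p = 0")
    case True
    then obtain c where "p = [:c:]" by (meson degree_eq_zeroE)
    with less.prems show ?thesis by (simp add: poly_op_pCons[OF T] linear_0[OF T])
  next
    case False
    then have "\<not> constant (poly (map_poly complex_of_real p))"
      by (simp add: constant_degree)
    then obtain z where z: "poly (map_poly complex_of_real p) z = 0"
      using fundamental_theorem_of_algebra by blast
    obtain f where f: "f dvd p" "f dvd conj_quadratic z" "Polynomial.degree f > 0"
    proof (cases "Im z = 0")
      case True
      then have zr: "z = complex_of_real (Re z)" by (simp add: complex_eq_iff)
      have "complex_of_real (poly p (Re z)) = 0"
        using z by (metis zr of_real_hom.poly_map_poly)
      then have "[:- Re z, 1:] dvd p"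
        by (simp add: poly_eq_0_iff_dvd)
      moreover have "conj_quadratic z = [:- Re z, 1:] * [:- Re z, 1:]"
        using True by (simp add: conj_quadratic_def power2_eq_square)
      then have "[:- Re z, 1:] dvd conj_quadratic z" by (metis dvd_triv_left)
      ultimately show ?thesis using that by simp
    next
      case False
      show ?thesis
        using that[OF conj_quadratic_dvd[OF z False]] by (simp add: degree_conj_quadratic)
    qed
    from f(1) obtain r where p: "p = f * r" by (auto simp: dvd_def)
    have r: "r \<noteq> 0" and deg: "Polynomial.degree p = Polynomial.degree f + Polynomial.degree r"
      using less.prems(1) by (auto simp: p degree_mult_eq)
    define y where "y = poly_op (?q ^ Polynomial.degree r) T x"
    have "poly_op r T (poly_op f T x) = 0"
      using less.prems(2) by (simp add: p mult.commute[of f] poly_op_mult[OF T])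
    then have "poly_op (?q ^ Polynomial.degree r) T (poly_op f T x) = 0"
      using less.hyps[of r] r deg f(3) by simp
    then have fy: "poly_op f T y = 0"
      by (simp add: y_def poly_op_commute[OF T])
    have "poly_op ?q T y = 0"
    proof (cases "z \<in> \<Sigma>")
      case True
      then have "f dvd ?q"
        using f(2) fin by (meson dvd_prodI dvd_trans)
      then show ?thesis using poly_op_dvd[OF T _ fy] by simp
    next
      case False
      have "poly_op (conj_quadratic z) T y = 0"
        using poly_op_dvd[OF T f(2) fy] .
      then have "y = 0"
        using eigenvalue_of_conj_quadratic_kernel[OF T] False spec by blast
      then show ?thesis by (simp add: poly_op_zero_arg[OF T])
    qed
    then have "poly_op (?q ^ Suc (Polynomial.degree r)) T x = 0"
      by (simp add: poly_op_mult[OF T] y_def)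
    then show ?thesis
      by (rule poly_op_dvd[OF T le_imp_power_dvd, rotated]) (use deg f(3) in simp)
  qed
qed

text \<open>
  A substitute for the theorem of Cayley and Hamilton in which the annihilating polynomial depends
  on the spectrum as a set only, and so is the same for all members of a family with constant
  spectrum.
\<close>

lemma annihilator_from_spectrum:
  fixes T :: "'a::euclidean_space \<Rightarrow> 'a"
  assumes T: "linear T" and fin: "finite \<Sigma>" and spec: "Spec T \<subseteq> \<Sigma>"
  shows "poly_op ((\<Prod>z\<in>\<Sigma>. conj_quadratic z) ^ DIM('a)) T x = 0"
proof -
  obtain p where p: "p \<noteq> 0" "Polynomial.degree p \<le> DIM('a)" "poly_op p T x = 0"
    by (rule vector_annihilator)
  show ?thesis
    by (rule poly_op_dvd[OF T le_imp_power_dvd[OF p(2)] annihilator_from_spectrum_aux[OF T fin spec p(1,3)]])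
qed

lemma coprime_conj_quadratics:
  assumes "w \<noteq> z" "w \<noteq> cnj z"
  shows "coprime (conj_quadratic w) (conj_quadratic z)"
proof (rule coprimeI)
  interpret hp: map_poly_comm_ring_hom complex_of_real ..
  fix d assume d: "d dvd conj_quadratic w" "d dvd conj_quadratic z"
  show "is_unit d"
  proof (rule ccontr)
    assume "\<not> is_unit d"
    then have "Polynomial.degree d \<noteq> 0"
      using d(1) by (metis conj_quadratic_nonzero dvd_0_left is_unit_iff_degree)
    then have "\<not> constant (poly (map_poly complex_of_real d))"
      by (simp add: constant_degree)
    then obtain u where u: "poly (map_poly complex_of_real d) u = 0"
      using fundamental_theorem_of_algebra by blast
    have "poly (map_poly complex_of_real q) u = 0" if "d dvd q" for q
      using that u by (auto simp: dvd_def hp.hom_mult)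
    from this[OF d(1)] this[OF d(2)] assms show False
      by (auto simp: poly_conj_quadratic)
  qed
qed

text \<open>
  The second summand is, modulo the product of the two powers, idempotent: evaluated at an operator
  with spectrum in \<open>A \<union> B\<close> it is the projection to the generalised eigenspaces for \<open>A\<close>.
\<close>

lemma splitting_polynomials:
  assumes disj: "\<And>z w. z \<in> A \<Longrightarrow> w \<in> B \<Longrightarrow> w \<noteq> z \<and> w \<noteq> cnj z"
  obtains u w where "u * (\<Prod>z\<in>A. conj_quadratic z) ^ n + w * (\<Prod>z\<in>B. conj_quadratic z) ^ n = 1"
proof -
  have "coprime (conj_quadratic z) (conj_quadratic w)" if "z \<in> A" "w \<in> B" for z w
    using coprime_conj_quadratics[of w z] disj[OF that] by (simp add: coprime_commute)
  then have "coprime ((\<Prod>z\<in>A. conj_quadratic z) ^ n) ((\<Prod>z\<in>B. conj_quadratic z) ^ n)"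
    by (intro coprime_power_left_iff[THEN iffD2] coprime_power_right_iff[THEN iffD2] disjI1
        prod_coprime_left prod_coprime_right) auto
  then show ?thesis
    using that bezout_coefficients_fst_snd[of "(\<Prod>z\<in>A. conj_quadratic z) ^ n" "(\<Prod>z\<in>B. conj_quadratic z) ^ n"]
    by (simp add: coprime_iff_gcd_eq_1)
qed

text \<open>
  Newton's iteration \<open>j \<mapsto> j - (j\<^sup>2 + 1) / (2 j)\<close> for a root of \<open>-1\<close>, with \<open>1 / j\<close> replaced by its
  approximation \<open>- j\<close>. A linear polynomial solves the case \<open>n = 1\<close>, and every step squares the
  power that divides \<open>j\<^sup>2 + 1\<close>.
\<close>

lemma complex_structure_polynomial:
  assumes "Im z \<noteq> 0"
  shows "\<exists>j. conj_quadratic z ^ n dvd j * j + 1"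
proof -
  have "\<exists>j. conj_quadratic z ^ (2 ^ k) dvd j * j + 1" for k
  proof (induction k)
    case 0
    define j :: "real poly" where "j = [:- Re z / Im z, 1 / Im z:]"
    have "j * j + 1 = Polynomial.smult (1 / (Im z)\<^sup>2) (conj_quadratic z)"
      using assms by (simp add: j_def conj_quadratic_def one_pCons field_simps power2_eq_square)
    then show ?case
      by (intro exI[of _ j]) (simp add: dvd_smult)
  next
    case (Suc k)
    then obtain j where j: "conj_quadratic z ^ (2 ^ k) dvd j * j + 1" by blast
    define i where "i = Polynomial.smult (1 / 2) (j * (3 + j * j))"
    \<comment> \<open>With \<open>u = j\<^sup>2 + 1\<close> the new error is \<open>u\<^sup>2 (3 + u) / 4\<close>.\<close>
    have "Polynomial.smult 4 (i * i + 1) = (j * j + 1) * (j * j + 1) * (4 + j * j)"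
    proof -
      have "Polynomial.smult 4 (i * i + 1) = (j * (3 + j * j)) * (j * (3 + j * j)) + 4"
        by (simp add: i_def smult_add_right numeral_poly)
      then show ?thesis by (simp add: algebra_simps)
    qed
    then have "conj_quadratic z ^ (2 ^ k) * conj_quadratic z ^ (2 ^ k) dvd Polynomial.smult 4 (i * i + 1)"
      using j by (simp add: mult_dvd_mono dvd_mult2)
    then have "conj_quadratic z ^ (2 ^ Suc k) dvd Polynomial.smult 4 (i * i + 1)"
      by (simp add: power_add[symmetric] mult_2[symmetric])
    then show ?case
      by (intro exI[of _ i]) (rule dvd_smult_cancel[of _ "4::real"], simp_all)
  qed
  from this[of n] show ?thesis
    by (meson dvd_trans le_imp_power_dvd less_imp_le less_exp)
qed

section \<open>Parallel transport\<close>

lemma lin_det_continuous_positive: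
  fixes F :: "'p::topological_space \<Rightarrow> 'a::euclidean_space \<Rightarrow> 'a"
  assumes F: "linear_family D F" and D: "connected D"
    and inj: "\<And>p x. p \<in> D \<Longrightarrow> F p x = 0 \<Longrightarrow> x = 0"
    and a: "a \<in> D" "lin_det (F a) > 0" and b: "b \<in> D"
  shows "lin_det (F b) > 0"
proof (rule ccontr)
  assume neg: "\<not> lin_det (F b) > 0"
  have "connected ((\<lambda>p. lin_det (F p)) ` D)"
    by (rule connected_continuous_image[OF continuous_on_lin_det[OF F] D])
  then have "0 \<in> (\<lambda>p. lin_det (F p)) ` D"
    using connectedD_interval[of _ "lin_det (F b)" "lin_det (F a)" 0] a b neg by auto
  then obtain p where "p \<in> D" "lin_det (F p) = 0" by auto
  then show False
    using lin_det_eq_0_iff[OF linear_familyD(1)[OF F]] inj by blast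
qed

text \<open>
  Let \<open>h y x\<close> be linear maps from the fibre over \<open>x\<close> to the fibre over \<open>y\<close>, with \<open>h x x\<close> the
  identity; by uniform continuity of the determinant they are invertible when \<open>x\<close> and \<open>y\<close> are
  close. Composing them along a fine subdivision of the segment from \<open>e\<close> to \<open>p\<close> gives an invertible
  map \<open>\<Gamma> p\<close> which depends continuously on \<open>p\<close>. The predicate \<open>\<Phi>\<close> stands for whatever structure the
  maps \<open>h\<close> preserve.
\<close>

theorem parallel_transport:
  fixes h :: "'b::real_normed_vector \<Rightarrow> 'b \<Rightarrow> 'a::euclidean_space \<Rightarrow> 'a"
  assumes D: "compact D" "convex D" and e: "e \<in> D"
    and h: "linear_family (D \<times> D) (\<lambda>q. h (fst q) (snd q))"
    and h_id: "\<And>p x. p \<in> D \<Longrightarrow> h p p x = x"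
    and base: "\<Phi> e (\<lambda>x. x)"
    and step: "\<And>p q L. p \<in> D \<Longrightarrow> q \<in> D \<Longrightarrow> linear L \<Longrightarrow> \<Phi> p L \<Longrightarrow> \<Phi> q (\<lambda>x. h q p (L x))"
  obtains \<Gamma> where "linear_family D \<Gamma>" "\<And>p. p \<in> D \<Longrightarrow> lin_det (\<Gamma> p) > 0" "\<And>p. p \<in> D \<Longrightarrow> \<Phi> p (\<Gamma> p)"
proof -
  have ucont: "uniformly_continuous_on (D \<times> D) (\<lambda>q. lin_det (h (fst q) (snd q)))"
    by (intro compact_uniformly_continuous continuous_on_lin_det[OF h] compact_Times D)
  obtain d where d: "d > 0" "\<And>q q'. q \<in> D \<times> D \<Longrightarrow> q' \<in> D \<times> D \<Longrightarrow> dist q' q < d \<Longrightarrow>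
      dist (lin_det (h (fst q') (snd q'))) (lin_det (h (fst q) (snd q))) < 1"
    using uniformly_continuous_onE[OF ucont, of 1] by auto
  have inj_step: "x = 0" if "p \<in> D" "q \<in> D" "dist q p < d" "h q p x = 0" for p q x
  proof (rule ccontr)
    assume "x \<noteq> 0"
    have "h p p = (\<lambda>x. x)"
      using h_id[OF that(1)] by (simp add: fun_eq_iff)
    then have "lin_det (h p p) = 1"
      by (simp add: lin_det_id)
    moreover have "lin_det (h q p) = 0"
      using lin_det_eq_0_iff[of "h q p"] linear_familyD(1)[OF h, of "(q, p)"] that \<open>x \<noteq> 0\<close> by auto
    ultimately show False
      using d(2)[of "(p, p)" "(q, p)"] that by (simp add: dist_Pair_Pair)
  qed
  obtain B where B: "\<And>p. p \<in> D \<Longrightarrow> norm (p - e) \<le> B"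
    using compact_imp_bounded[OF D(1)] bounded_any_center[of D e] by (auto simp: dist_norm norm_minus_commute)
  obtain N :: nat where N: "N > 0" "B / N < d"
  proof -
    obtain n :: nat where "B / d < n" using reals_Archimedean2 by blast
    then have "B < d * real (Suc n)" using d(1) by (simp add: field_simps)
    then show thesis using that[of "Suc n"] by (simp add: field_simps)
  qed
  \<comment> \<open>The subdivision points of the segment from \<open>e\<close> to \<open>p\<close>, less than \<open>d\<close> apart by the choice of \<open>N\<close>.\<close>
  define pt where "pt = (\<lambda>k p. e + (real k / real N) *\<^sub>R (p - e))"
  have pt_D: "pt k p \<in> D" if "k \<le> N" "p \<in> D" for k p
  proof -
    have "pt k p = (1 - real k / real N) *\<^sub>R e + (real k / real N) *\<^sub>R p"
      by (simp add: pt_def algebra_simps)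
    then show ?thesis
      using convexD_alt[OF D(2) e that(2), of "real k / real N"] that N by simp
  qed
  have pt_dist: "dist (pt (Suc k) p) (pt k p) < d" if "p \<in> D" for k p
  proof -
    have "pt (Suc k) p - pt k p = (1 / real N) *\<^sub>R (p - e)"
      by (simp add: pt_def scaleR_left_diff_distrib[symmetric] diff_divide_distrib[symmetric])
    then have "dist (pt (Suc k) p) (pt k p) = norm (p - e) / N"
      by (simp add: dist_norm)
    also have "\<dots> \<le> B / N" using B[OF that] by (simp add: divide_right_mono)
    finally show ?thesis using N by simp
  qed
  define \<Gamma> where "\<Gamma> = rec_nat (\<lambda>p x. x) (\<lambda>k G p x. h (pt (Suc k) p) (pt k p) (G p x))"
  have \<Gamma>_0: "\<Gamma> 0 p x = x" and \<Gamma>_Suc: "\<Gamma> (Suc k) p x = h (pt (Suc k) p) (pt k p) (\<Gamma> k p x)" for k p x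
    by (simp_all add: \<Gamma>_def)
  have main: "linear_family D (\<Gamma> k) \<and> (\<forall>p\<in>D. \<forall>x. \<Gamma> k p x = 0 \<longrightarrow> x = 0) \<and> (\<forall>p\<in>D. \<Phi> (pt k p) (\<Gamma> k p))"
    if "k \<le> N" for k
    using that
  proof (induction k)
    case 0
    have "\<Gamma> 0 = (\<lambda>p x. x)" by (simp add: \<Gamma>_0 fun_eq_iff)
    then show ?case using base by (simp add: linear_family_id pt_def)
  next
    case (Suc k)
    have IH: "linear_family D (\<Gamma> k)" "\<And>p x. p \<in> D \<Longrightarrow> \<Gamma> k p x = 0 \<Longrightarrow> x = 0" "\<And>p. p \<in> D \<Longrightarrow> \<Phi> (pt k p) (\<Gamma> k p)"
      using Suc.IH[OF Suc_leD[OF Suc.prems]] by blast+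
    have eq: "\<Gamma> (Suc k) = (\<lambda>p x. h (pt (Suc k) p) (pt k p) (\<Gamma> k p x))"
      by (simp add: \<Gamma>_Suc fun_eq_iff)
    have ptc: "continuous_on D (pt k)" for k
      unfolding pt_def by (intro continuous_intros)
    have "linear_family D (\<lambda>p. h (pt (Suc k) p) (pt k p))"
    proof -
      have "continuous_on D (\<lambda>p. (pt (Suc k) p, pt k p))"
        by (intro continuous_on_Pair ptc)
      moreover have "(\<lambda>p. (pt (Suc k) p, pt k p)) ` D \<subseteq> D \<times> D"
        using pt_D[of k] pt_D[of "Suc k"] Suc.prems by auto
      ultimately show ?thesis
        using linear_family_reparametrize[OF h, of D "\<lambda>p. (pt (Suc k) p, pt k p)"] by simp
    qed
    then have "linear_family D (\<Gamma> (Suc k))"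
      unfolding eq by (rule linear_family_compose[OF _ IH(1)])
    moreover have "x = 0" if p: "p \<in> D" and 0: "\<Gamma> (Suc k) p x = 0" for p x
    proof -
      have "\<Gamma> k p x = 0"
        by (rule inj_step[OF _ _ pt_dist[OF p]]) (use 0 pt_D[OF _ p] Suc.prems in \<open>simp_all add: eq\<close>)
      then show ?thesis by (rule IH(2)[OF p])
    qed
    moreover have "\<Phi> (pt (Suc k) p) (\<Gamma> (Suc k) p)" if "p \<in> D" for p
      unfolding eq
      by (rule step[OF pt_D[OF _ that] pt_D[OF _ that] linear_familyD(1)[OF IH(1) that] IH(3)[OF that]])
        (use Suc.prems in simp_all)
    ultimately show ?case by blast
  qed
  have \<Gamma>: "linear_family D (\<Gamma> N)" "\<And>p x. p \<in> D \<Longrightarrow> \<Gamma> N p x = 0 \<Longrightarrow> x = 0" "\<And>p. p \<in> D \<Longrightarrow> \<Phi> (pt N p) (\<Gamma> N p)"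
    using main[OF order.refl] by blast+
  \<comment> \<open>At \<open>e\<close> the path is constant, so the determinant is \<open>1\<close> there and stays positive on \<open>D\<close>.\<close>
  have "\<Gamma> k e x = x" if "k \<le> N" for k x
    using that by (induction k) (simp_all add: \<Gamma>_0 \<Gamma>_Suc pt_def h_id[OF e])
  then have "\<Gamma> N e = (\<lambda>x. x)" by (simp add: fun_eq_iff)
  then have det: "lin_det (\<Gamma> N p) > 0" if "p \<in> D" for p
    using lin_det_continuous_positive[OF \<Gamma>(1) convex_connected[OF D(2)] \<Gamma>(2) e _ that] by (simp add: lin_det_id)
  show ?thesis
    using that[OF \<Gamma>(1) det] \<Gamma>(3) N(1) by (simp add: pt_def)
qed

section \<open>Splittings of the tangent bundle of an even-dimensional sphere\<close>

text \<open>
  For a unit vector \<open>v\<close>, the orthogonal projection to the tangent space of the sphere at \<open>v\<close>.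
\<close>

definition tangent_part :: "'a::real_inner \<Rightarrow> 'a \<Rightarrow> 'a" where
  "tangent_part v x = x - (v \<bullet> x) *\<^sub>R v"

lemma linear_family_tangent_part: "linear_family S (\<lambda>v. tangent_part v)"
  unfolding tangent_part_def
  by (intro linear_family_diff linear_family_id linear_family_rank_one continuous_intros)

lemma linear_tangent_part: "linear (tangent_part v)" for v :: "'a::euclidean_space"
  using linear_familyD(1)[OF linear_family_tangent_part, of v UNIV] by simp

lemma tangent_part_inner: "norm v = 1 \<Longrightarrow> v \<bullet> tangent_part v x = 0"
  by (simp add: tangent_part_def inner_diff_right dot_square_norm)

lemma tangent_part_self: "norm v = 1 \<Longrightarrow> tangent_part v v = 0"
  by (simp add: tangent_part_def dot_square_norm)

lemma tangent_part_eq_self_iff: "norm v = 1 \<Longrightarrow> tangent_part v x = x \<longleftrightarrow> v \<bullet> x = 0"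
  by (auto simp: tangent_part_def)

lemma tangent_part_uminus: "tangent_part (- v) = tangent_part v"
  by (simp add: tangent_part_def fun_eq_iff)

text \<open>
  The image of a continuous family of projections is a vector bundle, and over a disc it has a
  nowhere vanishing section: transport a non-zero vector from the centre. The transport from \<open>z\<close> to
  \<open>y\<close> is \<open>P\<^sub>y P\<^sub>z + (1 - P\<^sub>y) (1 - P\<^sub>z)\<close>, which respects both the images and the kernels. The disc is
  the sphere without a cap around \<open>p\<close>, in stereographic coordinates centred at \<open>-p\<close>; the cap is
  chosen so that the regions for \<open>p\<close> and \<open>-p\<close> overlap in a belt.
\<close>

lemma section_away_from_a_point:
  fixes P :: "'a::euclidean_space \<Rightarrow> 'a \<Rightarrow> 'a"
  assumes P: "linear_family (sphere 0 1) P"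
    and idem: "\<And>v x. norm v = 1 \<Longrightarrow> P v (P v x) = P v x"
    and p: "norm p = 1" and x0: "x0 \<noteq> 0" "P (- p) x0 = x0"
  obtains X where "continuous_on {v. norm v = 1 \<and> v \<bullet> p \<le> 3/5} X"
    "\<And>v. norm v = 1 \<Longrightarrow> v \<bullet> p \<le> 3/5 \<Longrightarrow> X v \<noteq> 0 \<and> P v (X v) = X v"
proof -
  \<comment> \<open>The inverse stereographic projection \<open>\<theta>\<close> takes the disc of radius \<open>2\<close> onto the part of the sphere
    where \<open>v \<bullet> p \<le> (2\<^sup>2 - 1) / (2\<^sup>2 + 1) = 3/5\<close>.\<close>
  define D where "D = cball 0 2 \<inter> {x. p \<bullet> x = 0}"
  define \<theta> where "\<theta> = (\<lambda>x. (1 / (1 + (norm x)\<^sup>2)) *\<^sub>R (2 *\<^sub>R x + ((norm x)\<^sup>2 - 1) *\<^sub>R p))"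
  define h where "h = (\<lambda>y z x. P (\<theta> y) (P (\<theta> z) x) + ((x - P (\<theta> z) x) - P (\<theta> y) (x - P (\<theta> z) x)))"
  have pp: "p \<bullet> p = 1" using p by (simp add: dot_square_norm)
  have norm_\<theta>: "norm (\<theta> x) = 1" if "x \<in> D" for x
  proof -
    have pos: "1 + (norm x)\<^sup>2 > 0" by (simp add: add_pos_nonneg)
    have "(norm (2 *\<^sub>R x + ((norm x)\<^sup>2 - 1) *\<^sub>R p))\<^sup>2 = (1 + (norm x)\<^sup>2)\<^sup>2"
      using that pp unfolding power2_norm_eq_inner D_def
      by (simp add: inner_add_left inner_add_right inner_commute[of x p]) (simp add: power2_eq_square algebra_simps)
    then have "norm (2 *\<^sub>R x + ((norm x)\<^sup>2 - 1) *\<^sub>R p) = 1 + (norm x)\<^sup>2"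
      using pos by (simp add: power2_eq_iff_nonneg)
    then show ?thesis using pos by (simp add: \<theta>_def)
  qed
  have \<theta>D: "\<theta> ` D \<subseteq> sphere 0 1" using norm_\<theta> by auto
  have cont_\<theta>: "continuous_on D \<theta>"
    unfolding \<theta>_def by (intro continuous_intros) (smt (verit) zero_le_power2)
  have P1: "linear_family (D \<times> D) (\<lambda>q. P (\<theta> (fst q)))" and P2: "linear_family (D \<times> D) (\<lambda>q. P (\<theta> (snd q)))"
  proof -
    have "continuous_on (D \<times> D) (\<lambda>q. \<theta> (fst q))" "continuous_on (D \<times> D) (\<lambda>q. \<theta> (snd q))"
      by (rule continuous_on_compose2[OF cont_\<theta>]; force intro: continuous_intros)+
    then show "linear_family (D \<times> D) (\<lambda>q. P (\<theta> (fst q)))" "linear_family (D \<times> D) (\<lambda>q. P (\<theta> (snd q)))"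
      using \<theta>D linear_family_reparametrize[OF P, of "D \<times> D" "\<lambda>q. \<theta> (fst q)"]
        linear_family_reparametrize[OF P, of "D \<times> D" "\<lambda>q. \<theta> (snd q)"] by force+
  qed
  have h: "linear_family (D \<times> D) (\<lambda>q. h (fst q) (snd q))"
    unfolding h_def
    by (intro linear_family_add linear_family_diff linear_family_compose[OF P1] P2 linear_family_id)
  have linP: "linear (P (\<theta> x))" if "x \<in> D" for x
    using linear_familyD(1)[OF P] norm_\<theta>[OF that] by simp
  note idem\<theta> = idem[OF norm_\<theta>]
  obtain \<Gamma> where \<Gamma>: "linear_family D \<Gamma>" "\<And>x. x \<in> D \<Longrightarrow> lin_det (\<Gamma> x) > 0"
    "\<And>x. x \<in> D \<Longrightarrow> P (\<theta> x) (\<Gamma> x x0) = \<Gamma> x x0"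
  proof (rule parallel_transport[where D=D and e=0 and h=h and \<Phi>="\<lambda>x L. P (\<theta> x) (L x0) = L x0"])
    show "compact D" unfolding D_def
      by (intro compact_Int_closed compact_cball closed_hyperplane)
    show "convex D" unfolding D_def
      by (intro convex_Int convex_cball convex_hyperplane)
    show "0 \<in> D" by (simp add: D_def)
    show "h y y x = x" if "y \<in> D" for y x
      using idem\<theta>[OF that] linear_diff[OF linP[OF that]] by (simp add: h_def)
    show "P (\<theta> 0) x0 = x0" using x0 by (simp add: \<theta>_def)
    show "P (\<theta> y) (h y z (L x0)) = h y z (L x0)"
      if "z \<in> D" "y \<in> D" "P (\<theta> z) (L x0) = L x0" for y z L
      using that idem\<theta> by (simp add: h_def linear_0[OF linP])
  qed (use h in auto)
  define st where "st = (\<lambda>v. (1 / (1 - v \<bullet> p)) *\<^sub>R (v - (v \<bullet> p) *\<^sub>R p))"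
  let ?C = "{v. norm v = 1 \<and> v \<bullet> p \<le> 3/5}"
  have st: "st v \<in> D" "\<theta> (st v) = v" if v: "v \<in> ?C" for v
  proof -
    define c where "c = v \<bullet> p"
    have c: "c \<le> 3/5" and vv: "v \<bullet> v = 1" using v by (auto simp: c_def dot_square_norm)
    have n: "(norm (st v))\<^sup>2 = (1 + c) / (1 - c)"
    proof -
      have "(norm (v - c *\<^sub>R p))\<^sup>2 = (1 + c) * (1 - c)"
        using vv pp by (simp add: power2_norm_eq_inner inner_diff_left inner_diff_right c_def[symmetric]
            inner_commute[of p v]) (simp add: algebra_simps)
      then have "(norm (st v))\<^sup>2 = (1 + c) * (1 - c) / (1 - c)\<^sup>2"
        using c by (simp add: st_def c_def[symmetric] power_divide)
      then show ?thesis
        using c by (simp add: power2_eq_square)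
    qed
    also have "\<dots> \<le> 2\<^sup>2" using c by (simp add: field_simps)
    finally have "norm (st v) \<le> 2" by (rule power2_le_imp_le) simp
    moreover have "p \<bullet> st v = 0"
      using pp by (simp add: st_def inner_diff_right inner_commute)
    ultimately show "st v \<in> D" by (simp add: D_def)
    have "1 + (norm (st v))\<^sup>2 = 2 / (1 - c)" "(norm (st v))\<^sup>2 - 1 = 2 * c / (1 - c)"
      using c by (simp_all add: n field_simps)
    then show "\<theta> (st v) = v"
      using c by (simp add: \<theta>_def) (simp add: st_def c_def[symmetric] scaleR_add_right algebra_simps)
  qed
  have cont_st: "continuous_on ?C st"
    unfolding st_def by (intro continuous_intros) auto
  define X where "X = (\<lambda>v. \<Gamma> (st v) x0)"
  have "continuous_on ?C X"
    unfolding X_def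
    by (rule continuous_on_compose2[OF linear_familyD(2)[OF \<Gamma>(1)] cont_st]) (use st in auto)
  moreover have "X v \<noteq> 0 \<and> P v (X v) = X v" if "norm v = 1" "v \<bullet> p \<le> 3/5" for v
  proof
    have v: "v \<in> ?C" using that by simp
    show "P v (X v) = X v"
      using \<Gamma>(3)[OF st(1)[OF v]] by (simp add: X_def st(2)[OF v])
    show "X v \<noteq> 0"
      using \<Gamma>(2)[OF st(1)[OF v]] lin_det_eq_0_iff[OF linear_familyD(1)[OF \<Gamma>(1) st(1)[OF v]]] x0(1)
      unfolding X_def by (metis less_irrefl)
  qed
  ultimately show ?thesis using that by blast
qed

text \<open>
  The complementary projection \<open>Q\<close> vanishes everywhere. If \<open>Q\<close> were non-zero at \<open>p\<close>, a section \<open>X\<close> of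
  the image of \<open>P\<close> away from \<open>p\<close> and a section \<open>Y\<close> of the image of \<open>Q\<close> away from \<open>-p\<close> could be
  combined with a cut-off function. The sum has no zeros because the two images intersect trivially,
  and so contradicts the hairy ball theorem.
\<close>

theorem tangent_projection_trivial:
  fixes P :: "'a::euclidean_space \<Rightarrow> 'a \<Rightarrow> 'a"
  assumes odd: "odd DIM('a)" and P: "linear_family (sphere 0 1) P"
    and idem: "\<And>v x. norm v = 1 \<Longrightarrow> P v (P v x) = P v x"
    and normal: "\<And>v. norm v = 1 \<Longrightarrow> P v v = 0"
    and tangent: "\<And>v x. norm v = 1 \<Longrightarrow> v \<bullet> P v x = 0"
    and nonzero: "\<And>v. norm v = 1 \<Longrightarrow> \<exists>x. P v x \<noteq> 0"
    and p: "norm p = 1"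
  shows "P p x = tangent_part p x"
proof (rule ccontr)
  assume neq: "P p x \<noteq> tangent_part p x"
  define Q where "Q = (\<lambda>v x. tangent_part v x - P v x)"
  have P_tangent: "P v (tangent_part v x) = P v x" if "norm v = 1" for v x
    using that normal linear_familyD(1)[OF P, of v]
    by (simp add: tangent_part_def linear_diff linear_scale)
  have Pdiff: "P v (x - y) = P v x - P v y" if "norm v = 1" for v x y
    using that linear_familyD(1)[OF P, of v] by (simp add: linear_diff)
  have tan_P: "tangent_part v (P v x) = P v x" if "norm v = 1" for v x
    using that tangent by (simp add: tangent_part_eq_self_iff)
  have tan_tan: "tangent_part v (tangent_part v x) = tangent_part v x" if "norm v = 1" for v x :: 'a
    using that by (simp add: tangent_part_eq_self_iff tangent_part_inner)
  have Q: "linear_family (sphere 0 1) Q"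
    unfolding Q_def by (intro linear_family_diff linear_family_tangent_part P)
  have Q_idem: "Q v (Q v x) = Q v x" and PQ: "P v (Q v x) = 0" and Q_tangent: "v \<bullet> Q v x = 0"
    if "norm v = 1" for v x
    using that tangent idem
    by (simp_all add: Q_def linear_diff[OF linear_tangent_part] Pdiff P_tangent tan_P tan_tan
        inner_diff_right tangent_part_inner)
  obtain u where u: "P (- p) u \<noteq> 0" using nonzero[of "- p"] p by auto
  obtain X where X: "continuous_on {v. norm v = 1 \<and> v \<bullet> p \<le> 3/5} X"
    "\<And>v. norm v = 1 \<Longrightarrow> v \<bullet> p \<le> 3/5 \<Longrightarrow> X v \<noteq> 0 \<and> P v (X v) = X v"
    using section_away_from_a_point[OF P idem p u] idem[of "- p"] p by auto
  have "Q p x \<noteq> 0" using neq by (simp add: Q_def)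
  then obtain Y where Y: "continuous_on {v. norm v = 1 \<and> v \<bullet> (- p) \<le> 3/5} Y"
    "\<And>v. norm v = 1 \<Longrightarrow> v \<bullet> (- p) \<le> 3/5 \<Longrightarrow> Y v \<noteq> 0 \<and> Q v (Y v) = Y v"
    using section_away_from_a_point[OF Q Q_idem, of "- p" "Q p x"] Q_idem[OF p] p by auto
  \<comment> \<open>Both sections are defined on the belt \<open>\<bar>v \<bullet> p\<bar> \<le> 1/2\<close>, where the cut-off function \<open>\<phi>\<close> passes
    from \<open>1\<close> to \<open>0\<close>.\<close>
  define \<phi> where "\<phi> = (\<lambda>v. max 0 (min 1 (1/2 - v \<bullet> p)))"
  define Z where "Z = (\<lambda>v. (if v \<bullet> p \<le> 1/2 then \<phi> v *\<^sub>R X v else 0) +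
      (if v \<bullet> (- p) \<le> 1/2 then (1 - \<phi> v) *\<^sub>R Y v else 0))"
  have cont_\<phi>: "continuous_on A \<phi>" for A
    unfolding \<phi>_def by (intro continuous_intros)
  have "continuous_on (sphere 0 1) Z"
    unfolding Z_def
  proof (rule continuous_on_add)
    show "continuous_on (sphere 0 1) (\<lambda>v. if v \<bullet> p \<le> 1/2 then \<phi> v *\<^sub>R X v else 0)"
      by (rule continuous_on_cases_le) (auto simp: \<phi>_def[of] intro!: continuous_intros cont_\<phi> continuous_on_subset[OF X(1)])
    show "continuous_on (sphere 0 1) (\<lambda>v. if v \<bullet> (- p) \<le> 1/2 then (1 - \<phi> v) *\<^sub>R Y v else 0)"
      by (rule continuous_on_cases_le) (auto simp: \<phi>_def[of] intro!: continuous_intros cont_\<phi> continuous_on_subset[OF Y(1)])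
  qed
  moreover have "Z v \<bullet> v = 0" if v: "norm v = 1" for v
  proof -
    have "v \<bullet> X v = 0" if "v \<bullet> p \<le> 1/2"
      using X(2)[OF v] tangent[OF v, of "X v"] that by auto
    moreover have "v \<bullet> Y v = 0" if "v \<bullet> (- p) \<le> 1/2"
      using Y(2)[OF v] Q_tangent[OF v, of "Y v"] that by auto
    ultimately show ?thesis
      by (simp add: Z_def inner_add_left inner_add_right inner_commute[of _ v])
  qed
  moreover have "Z v \<noteq> 0" if v: "norm v = 1" for v
  proof
    assume Z0: "Z v = 0"
    have lin: "linear (P v)" using linear_familyD(1)[OF P] v by simp
    have PX: "v \<bullet> p \<le> 1/2 \<Longrightarrow> X v \<noteq> 0 \<and> P v (X v) = X v" using X(2)[OF v] by simp
    have PY: "v \<bullet> (- p) \<le> 1/2 \<Longrightarrow> Y v \<noteq> 0 \<and> P v (Y v) = 0" using Y(2)[OF v] PQ[OF v, of "Y v"] by simp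
    \<comment> \<open>\<open>P v\<close> extracts the contribution of \<open>X\<close>, so both contributions vanish with \<open>Z v\<close>.\<close>
    have "P v (Z v) = (if v \<bullet> p \<le> 1/2 then \<phi> v *\<^sub>R X v else 0)"
      using PX PY by (auto simp: Z_def linear_add[OF lin] linear_scale[OF lin] linear_0[OF lin])
    then have "(if v \<bullet> p \<le> 1/2 then \<phi> v *\<^sub>R X v else 0) = 0"
      using Z0 by (simp add: linear_0[OF lin])
    moreover from this have "(if v \<bullet> (- p) \<le> 1/2 then (1 - \<phi> v) *\<^sub>R Y v else 0) = 0"
      using Z0 by (simp add: Z_def)
    ultimately show False
      using PX PY by (auto simp: \<phi>_def split: if_splits)
  qed
  ultimately show False
    by (rule hairy_ball[OF odd])
qed

section \<open>Complex structures on the tangent spaces of a sphere\<close>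

text \<open>
  On the complement of \<open>e\<close> the map \<open>H\<close> is complex linear, so its determinant should be the square of
  an absolute value. This is seen by joining \<open>H\<close> to the identity by
  \<open>(1 - t) H + t + \<epsilon> t (1 - t) I\<close>. A kernel vector of such a map makes
  \<open>- t / (1 - t) + \<i> \<epsilon> t\<close> an eigenvalue of \<open>H\<close>, which happens only for finitely many values of \<open>\<epsilon>\<close>.
\<close>

lemma commuting_with_complex_structure_det:
  fixes H I :: "'a::euclidean_space \<Rightarrow> 'a"
  assumes H: "linear H" and I: "linear I" and e: "norm e = 1"
    and Ie: "I e = 0" and II: "\<And>x. I (I x) = - tangent_part e x"
    and comm: "\<And>x. H (I x) = I (H x)" and He: "H e = e"
    and det: "lin_det H \<noteq> 0"
  shows "lin_det H > 0"
proof -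
  \<comment> \<open>Contains all values of \<open>\<epsilon>\<close> for which an eigenvalue of \<open>H\<close> has the form \<open>- t / (1 - t) + \<i> \<epsilon> t\<close>.\<close>
  define bad where "bad = (\<lambda>z. Im z * (1 - Re z) / (- Re z)) ` Spec H"
  have "finite bad" unfolding bad_def by (intro finite_imageI finite_Spec)
  then have "{0<..<1::real} - bad \<noteq> {}"
    using \<open>finite bad\<close> finite_subset[of "{0<..<1::real}" bad] infinite_Ioo[of "0::real" 1] by auto
  then obtain \<epsilon> where \<epsilon>: "\<epsilon> > 0" "\<epsilon> \<notin> bad"
    by (metis (mono_tags) Diff_iff ex_in_conv greaterThanLessThan_iff)
  define C where "C = (\<lambda>t x. (1 - t) *\<^sub>R H x + (t *\<^sub>R x + (\<epsilon> * t * (1 - t)) *\<^sub>R I x))"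
  have C: "linear_family {0..1} C"
    unfolding C_def
    by (intro linear_family_add linear_family_scaleR linear_family_id continuous_intros)
      (simp_all add: linear_family_def H I)
  have eI: "e \<bullet> I x = 0" for x
  proof -
    have "I (tangent_part e x) = I x"
      using Ie by (simp add: tangent_part_def linear_diff[OF I] linear_scale[OF I])
    then have "tangent_part e (I x) = I x"
      using II[of "I x"] arg_cong[OF II[of x], of I] by (simp add: linear_neg[OF I])
    then show ?thesis using e by (simp add: tangent_part_eq_self_iff)
  qed
  have eH: "e \<bullet> H x = e \<bullet> x" for x
  proof -
    have "H (tangent_part e x) = tangent_part e (H x)"
      using II[of x] II[of "H x"] comm[of x] comm[of "I x"] linear_neg[OF H, of "tangent_part e x"] by simp
    then have "(e \<bullet> x) *\<^sub>R e = (e \<bullet> H x) *\<^sub>R e"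
      using He by (simp add: tangent_part_def linear_diff[OF H] linear_scale[OF H])
    then show ?thesis using e by auto
  qed
  have inj: "x = 0" if t: "t \<in> {0..1}" and Cx: "C t x = 0" for t x
  proof (rule ccontr)
    assume x: "x \<noteq> 0"
    consider "t = 0" | "t = 1" | "0 < t" "t < 1" using t by fastforce
    then show False
    proof cases
      case 1
      then have "H x = 0" using Cx by (simp add: C_def)
      then show False using x det lin_det_eq_0_iff[OF H] by blast
    next
      case 2
      then show False using Cx x by (simp add: C_def)
    next
      case 3
      have "e \<bullet> C t x = e \<bullet> x"
        by (simp add: C_def inner_add_right eH eI) (simp add: algebra_simps)
      then have "I (I x) = - x"
        using Cx II[of x] by (simp add: tangent_part_def)
      define r where "r = t / (1 - t)"
      have "(1 - t) *\<^sub>R H x = (1 - t) *\<^sub>R (- r *\<^sub>R x - (\<epsilon> * t) *\<^sub>R I x)"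
      proof -
        have "(1 - t) * r = t" using 3 by (simp add: r_def)
        then have "(1 - t) *\<^sub>R (- r *\<^sub>R x - (\<epsilon> * t) *\<^sub>R I x) = - (t *\<^sub>R x + (\<epsilon> * t * (1 - t)) *\<^sub>R I x)"
          by (simp add: scaleR_diff_right mult.commute mult.left_commute)
        moreover have "(1 - t) *\<^sub>R H x = - (t *\<^sub>R x + (\<epsilon> * t * (1 - t)) *\<^sub>R I x)"
          using Cx by (simp only: C_def eq_neg_iff_add_eq_0)
        ultimately show ?thesis by simp
      qed
      then have Hx: "H x = - r *\<^sub>R x - (\<epsilon> * t) *\<^sub>R I x"
        using 3 by simp
      have HIx: "H (I x) = (\<epsilon> * t) *\<^sub>R x + (- r) *\<^sub>R I x"
        using \<open>I (I x) = - x\<close>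
        by (simp add: comm Hx linear_diff[OF I] linear_scale[OF I] linear_neg[OF I])
      have "eigenpair H (Complex (- r) (\<epsilon> * t)) x (I x)"
        using x Hx HIx by (simp add: eigenpair_def)
      then have "Complex (- r) (\<epsilon> * t) \<in> Spec H"
        using Spec_iff_eigenpair[OF H] by blast
      moreover have "\<epsilon> * t * (1 + r) / r = \<epsilon>"
        using 3 by (simp add: r_def field_simps)
      ultimately have "\<epsilon> \<in> bad"
        unfolding bad_def by (intro image_eqI[of _ _ "Complex (- r) (\<epsilon> * t)"]) simp_all
      then show False using \<epsilon> by simp
    qed
  qed
  have "lin_det (C 0) > 0"
  proof (rule lin_det_continuous_positive[OF C connected_Icc, where a=1])
    show "x = 0" if "t \<in> {0..1}" "C t x = 0" for t x
      using that by (rule inj)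
  qed (simp_all add: C_def lin_det_id)
  then show ?thesis by (simp add: C_def)
qed

text \<open>
  Transport along the half great circle from \<open>e\<close> to \<open>-e\<close> by maps that intertwine the complex
  structures and take radial vectors to radial vectors. The result \<open>\<Gamma> 1\<close> has positive determinant,
  commutes with \<open>I e\<close> and takes \<open>e\<close> to \<open>-e\<close>. Then \<open>- \<Gamma> 1\<close> fixes \<open>e\<close> and has, in odd
  dimension, negative determinant, which complex linearity forbids.
\<close>

theorem no_antipodal_complex_structure:
  fixes I :: "'a::euclidean_space \<Rightarrow> 'a \<Rightarrow> 'a"
  assumes odd: "odd DIM('a)" and dim: "DIM('a) \<ge> 2" and I: "linear_family (sphere 0 1) I"
    and normal: "\<And>v. norm v = 1 \<Longrightarrow> I v v = 0"
    and II: "\<And>v x. norm v = 1 \<Longrightarrow> I v (I v x) = - tangent_part v x"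
    and antipodal: "\<And>v x. norm v = 1 \<Longrightarrow> I (- v) x = I v x"
  shows False
proof -
  obtain e :: 'a where "e \<in> Basis" using nonempty_Basis by blast
  then have e: "norm e = 1" by simp
  obtain f :: 'a where "norm f = 1" "e \<bullet> f = 0"
  proof -
    have "Basis - {e} \<noteq> {}"
    proof
      assume "Basis - {e} = {}"
      then have "card (Basis :: 'a set) \<le> card {e}" by (intro card_mono) auto
      then show False using dim by simp
    qed
    then obtain f where "f \<in> Basis" "f \<noteq> e" by auto
    then show thesis using that[of f] \<open>e \<in> Basis\<close> by (simp add: inner_Basis)
  qed
  note f = this
  define g where "g = (\<lambda>t. cos (pi * t) *\<^sub>R e + sin (pi * t) *\<^sub>R f)"
  have norm_g: "norm (g t) = 1" for t
  proof -
    have "(norm (g t))\<^sup>2 = 1"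
    proof -
      have "e \<bullet> e = 1" "f \<bullet> f = 1" "e \<bullet> f = 0" "f \<bullet> e = 0"
        using e f by (simp_all add: dot_square_norm inner_commute[of f e])
      then show ?thesis
        by (simp add: power2_norm_eq_inner g_def inner_add_left inner_add_right power2_eq_square[symmetric])
    qed
    then show ?thesis by (simp add: power2_eq_1_iff) (smt (verit) norm_ge_zero)
  qed
  have gg: "g t \<bullet> g t = 1" for t using norm_g[of t] by (simp add: dot_square_norm)
  have lin: "linear (I (g t))" for t using linear_familyD(1)[OF I] norm_g[of t] by simp
  have I_tan: "I (g t) (tangent_part (g t) x) = I (g t) x" for t x
    using normal[OF norm_g] by (simp add: tangent_part_def linear_diff[OF lin] linear_scale[OF lin])
  have tan_I: "tangent_part (g t) (I (g t) x) = I (g t) x" for t x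
    using II[OF norm_g, of t "I (g t) x"] arg_cong[OF II[OF norm_g, of t x], of "I (g t)"]
    by (simp add: linear_neg[OF lin] I_tan)
  have tan_tan: "tangent_part (g t) (tangent_part (g t) x) = tangent_part (g t) x" for t x
    by (simp add: tangent_part_eq_self_iff tangent_part_inner norm_g)
  \<comment> \<open>For two complex structures, \<open>1 - I\<^sub>t I\<^sub>s\<close> intertwines \<open>I\<^sub>s\<close> and \<open>I\<^sub>t\<close>, and it is twice the identity
    for \<open>s = t\<close>. As the two tangent spaces differ, the product of the two projections takes the place of
    \<open>1\<close>. The first summand is added to carry \<open>g s\<close> to \<open>g t\<close>.\<close>
  define h where "h = (\<lambda>t s x. (g s \<bullet> x) *\<^sub>R g t +
    (1/2) *\<^sub>R (tangent_part (g t) (tangent_part (g s) x) - I (g t) (I (g s) x)))"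
  have cont_g1: "continuous_on A (\<lambda>q. g (fst q))" and cont_g2: "continuous_on A (\<lambda>q. g (snd q))"
    for A :: "(real \<times> real) set"
    unfolding g_def by (intro continuous_intros)+
  have reparam: "linear_family ({0..1::real} \<times> {0..1::real}) (\<lambda>q. F (g (fst q)))"
    "linear_family ({0..1::real} \<times> {0..1::real}) (\<lambda>q. F (g (snd q)))" if "linear_family (sphere 0 1) F" for F :: "'a \<Rightarrow> 'a \<Rightarrow> 'a"
  proof -
    have sub: "(\<lambda>q. g (fst q)) ` ({0..1::real} \<times> {0..1::real}) \<subseteq> sphere 0 1" "(\<lambda>q. g (snd q)) ` ({0..1::real} \<times> {0..1::real}) \<subseteq> sphere 0 1"
      using norm_g by auto
    show "linear_family ({0..1::real} \<times> {0..1::real}) (\<lambda>q. F (g (fst q)))"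
      by (rule linear_family_reparametrize[OF that cont_g1 sub(1)])
    show "linear_family ({0..1::real} \<times> {0..1::real}) (\<lambda>q. F (g (snd q)))"
      by (rule linear_family_reparametrize[OF that cont_g2 sub(2)])
  qed
  have h: "linear_family ({0..1::real} \<times> {0..1::real}) (\<lambda>q. h (fst q) (snd q))"
    unfolding h_def
  proof (intro linear_family_add linear_family_diff linear_family_scaleR continuous_on_const)
    show "linear_family ({0..1::real} \<times> {0..1::real}) (\<lambda>q x. (g (snd q) \<bullet> x) *\<^sub>R g (fst q))"
      by (rule linear_family_rank_one[OF cont_g2 cont_g1])
    show "linear_family ({0..1::real} \<times> {0..1::real}) (\<lambda>q x. tangent_part (g (fst q)) (tangent_part (g (snd q)) x))"
      by (rule linear_family_compose[OF reparam(1)[OF linear_family_tangent_part] reparam(2)[OF linear_family_tangent_part]])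
    show "linear_family ({0..1::real} \<times> {0..1::real}) (\<lambda>q x. I (g (fst q)) (I (g (snd q)) x))"
      by (rule linear_family_compose[OF reparam(1)[OF I] reparam(2)[OF I]])
  qed
  obtain \<Gamma> where \<Gamma>: "linear_family {0..1::real} \<Gamma>" "\<And>t. t \<in> {0..1} \<Longrightarrow> lin_det (\<Gamma> t) > 0"
    "\<And>t. t \<in> {0..1} \<Longrightarrow> \<Gamma> t e = g t \<and> (\<forall>x. \<Gamma> t (I e x) = I (g t) (\<Gamma> t x))"
  proof (rule parallel_transport[where D="{0..1::real}" and e=0 and h=h
        and \<Phi>="\<lambda>t L. L e = g t \<and> (\<forall>x. L (I e x) = I (g t) (L x))"])
    show "h t t x = x" for t x
    proof -
      have "h t t x = (g t \<bullet> x) *\<^sub>R g t + (1/2) *\<^sub>R (tangent_part (g t) x + tangent_part (g t) x)"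
        by (simp add: h_def II[OF norm_g] tan_tan)
      also have "\<dots> = (g t \<bullet> x) *\<^sub>R g t + tangent_part (g t) x"
        by (simp only: scaleR_add_right scaleR_add_left[symmetric]) simp
      finally show ?thesis by (simp add: tangent_part_def)
    qed
    have h_g: "h t s (g s) = g t" for t s
      using normal[OF norm_g] gg
      by (simp add: h_def tangent_part_self norm_g linear_0[OF lin] linear_0[OF linear_tangent_part])
    have h_I: "h t s (I (g s) x) = I (g t) (h t s x)" for t s x
    proof -
      have "g s \<bullet> I (g s) x = 0"
        using tan_I norm_g by (metis tangent_part_eq_self_iff)
      then have "h t s (I (g s) x) = (1/2) *\<^sub>R (tangent_part (g t) (I (g s) x) + I (g t) (tangent_part (g s) x))"
        by (simp add: h_def tan_I II[OF norm_g] linear_neg[OF lin])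
      also have "\<dots> = I (g t) (h t s x)"
        by (simp add: h_def linear_add[OF lin] linear_scale[OF lin] linear_diff[OF lin] normal[OF norm_g] I_tan II[OF norm_g])
      finally show ?thesis .
    qed
    show "h t s (L e) = g t \<and> (\<forall>x. h t s (L (I e x)) = I (g t) (h t s (L x)))"
      if "L e = g s \<and> (\<forall>x. L (I e x) = I (g s) (L x))" for t s L
      using that h_g h_I by simp
    show "e = g 0 \<and> (\<forall>x. I e x = I (g 0) x)" by (simp add: g_def)
  qed (use h in auto)
  have G: "linear (\<Gamma> 1)" using linear_familyD(1)[OF \<Gamma>(1)] by simp
  have g1: "g 1 = - e" by (simp add: g_def)
  have det: "lin_det (\<lambda>x. - \<Gamma> 1 x) < 0"
    using \<Gamma>(2)[of 1] odd by (simp add: lin_det_uminus)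
  have "lin_det (\<lambda>x. - \<Gamma> 1 x) > 0"
  proof (rule commuting_with_complex_structure_det[of _ "I e" e])
    have lie: "linear (I e)" using linear_familyD(1)[OF I] e by simp
    then show "linear (I e)" .
    show "linear (\<lambda>x. - \<Gamma> 1 x)" using G by (rule linear_compose_neg)
    show "- \<Gamma> 1 (I e x) = I e (- \<Gamma> 1 x)" for x
      using \<Gamma>(3)[of 1] antipodal[OF e] by (simp add: g1 linear_neg[OF lie])
    show "- \<Gamma> 1 e = e" using \<Gamma>(3)[of 1] by (simp add: g1)
  qed (use e det normal II in auto)
  with det show False by simp
qed

section \<open>Operators with proportional spectra\<close>

definition spectral_radius_of :: "('a::euclidean_space \<Rightarrow> 'a) \<Rightarrow> real" where
  "spectral_radius_of T = Max (cmod ` Spec T)"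

lemma Spec_nonempty: "Spec (T :: 'a::euclidean_space \<Rightarrow> 'a) \<noteq> {}"
proof -
  obtain as where "length as = DIM('a)" "set as = Spec T"
    by (rule eigenvalue_list)
  then show ?thesis using DIM_positive[where 'a='a] by (metis length_0_conv less_irrefl set_empty2)
qed

lemma spectral_radius_ge: "z \<in> Spec T \<Longrightarrow> cmod z \<le> spectral_radius_of T"
  unfolding spectral_radius_of_def by (intro Max_ge) (simp_all add: finite_Spec)

lemma spectral_radius_attained: "\<exists>z\<in>Spec T. cmod z = spectral_radius_of T"
proof -
  have "spectral_radius_of T \<in> cmod ` Spec T"
    unfolding spectral_radius_of_def by (intro Max_in) (simp_all add: finite_Spec Spec_nonempty)
  then show ?thesis by auto
qed

lemma spectral_radius_proportional:
  assumes "Spec T = (\<lambda>z. complex_of_real s * z) ` Spec U"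
  shows "spectral_radius_of T = \<bar>s\<bar> * spectral_radius_of U"
proof (rule antisym)
  obtain z where "z \<in> Spec T" "cmod z = spectral_radius_of T"
    using spectral_radius_attained by blast
  then obtain y where "y \<in> Spec U" "spectral_radius_of T = \<bar>s\<bar> * cmod y"
    using assms by (auto simp: norm_mult)
  then show "spectral_radius_of T \<le> \<bar>s\<bar> * spectral_radius_of U"
    by (simp add: mult_left_mono spectral_radius_ge)
  obtain z where z: "z \<in> Spec U" "cmod z = spectral_radius_of U"
    using spectral_radius_attained by blast
  then have "cmod (complex_of_real s * z) \<le> spectral_radius_of T"
    by (intro spectral_radius_ge) (unfold assms, rule imageI)
  then show "\<bar>s\<bar> * spectral_radius_of U \<le> spectral_radius_of T"
    by (simp add: norm_mult z)
qed

lemma Spec_scale: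
  fixes T :: "'a::euclidean_space \<Rightarrow> 'a"
  assumes T: "linear T" and c: "c \<noteq> 0"
  shows "Spec (\<lambda>x. c *\<^sub>R T x) = (\<lambda>z. complex_of_real c * z) ` Spec T"
proof -
  have sub: "complex_of_real c * z \<in> Spec (\<lambda>x. c *\<^sub>R T x)" if T: "linear T" and z: "z \<in> Spec T" for c z and T :: "'a \<Rightarrow> 'a"
  proof -
    obtain x y where "eigenpair T z x y" using z Spec_iff_eigenpair[OF T] by blast
    then have "eigenpair (\<lambda>x. c *\<^sub>R T x) (complex_of_real c * z) x y"
      by (simp add: eigenpair_def scaleR_diff_right scaleR_add_right)
    then show ?thesis
      using Spec_iff_eigenpair[OF linear_compose_scale_right[OF T]] by blast
  qed
  show ?thesis
  proof
    show "(\<lambda>z. complex_of_real c * z) ` Spec T \<subseteq> Spec (\<lambda>x. c *\<^sub>R T x)"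
      using sub[OF T] by auto
    show "Spec (\<lambda>x. c *\<^sub>R T x) \<subseteq> (\<lambda>z. complex_of_real c * z) ` Spec T"
    proof
      fix z assume "z \<in> Spec (\<lambda>x. c *\<^sub>R T x)"
      from sub[OF linear_compose_scale_right[OF T] this, of "1 / c"] have "z / complex_of_real c \<in> Spec T"
        using c by (simp add: field_simps)
      then show "z \<in> (\<lambda>z. complex_of_real c * z) ` Spec T"
        using c by (intro image_eqI[of _ _ "z / complex_of_real c"]) simp_all
    qed
  qed
qed

text \<open>
  The abstract form of the projective Osserman condition: the spectra of a continuous family over
  a connected space agree up to non-zero real factors. What has to be found is a continuous choice of
  these factors.
\<close>

locale proportional_spectra =
  fixes S :: "'p::topological_space set" and F :: "'p \<Rightarrow> 'a::euclidean_space \<Rightarrow> 'a" and e :: 'p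
  assumes F: "linear_family S F" and S: "connected S" and e: "e \<in> S"
    and proportional: "\<And>v w. v \<in> S \<Longrightarrow> w \<in> S \<Longrightarrow> \<exists>s::real. s \<noteq> 0 \<and> Spec (F v) = (\<lambda>z. complex_of_real s * z) ` Spec (F w)"
    and nonzero: "\<And>v. v \<in> S \<Longrightarrow> \<exists>z\<in>Spec (F v). z \<noteq> 0"
begin

lemma spectral_radius_positive: "v \<in> S \<Longrightarrow> spectral_radius_of (F v) > 0"
  using nonzero spectral_radius_ge by (metis norm_le_zero_iff not_le_imp_less order.trans)

text \<open>
  By \<open>near_eigenvalue\<close>, every eigenvalue of \<open>F v\<close> is close to one of \<open>F w\<close> when \<open>w\<close> is close to \<open>v\<close>.
  Used for an eigenvalue of maximal modulus, this bounds the spectral radius of \<open>F w\<close> from below.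
  Used for a non-zero eigenvalue of minimal modulus, it bounds the factor between the two spectra,
  and hence the spectral radius of \<open>F w\<close>, from above.
\<close>

lemma spectral_radius_continuous: "continuous_on S (\<lambda>v. spectral_radius_of (F v))"
  unfolding continuous_on_def
proof (intro ballI tendstoI)
  fix v and \<eta> :: real assume v: "v \<in> S" and \<eta>: "\<eta> > 0"
  let ?r = "\<lambda>v. spectral_radius_of (F v)"
  obtain z1 where z1: "z1 \<in> Spec (F v)" "cmod z1 = ?r v"
    using spectral_radius_attained by blast
  have fin: "finite (Spec (F v) - {0})" by (simp add: finite_Spec)
  have ne: "Spec (F v) - {0} \<noteq> {}" using nonzero[OF v] by auto
  obtain z2 where z2: "z2 \<in> Spec (F v)" "z2 \<noteq> 0" "\<And>z. z \<in> Spec (F v) \<Longrightarrow> z \<noteq> 0 \<Longrightarrow> cmod z2 \<le> cmod z"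
    using arg_min_least[OF fin ne, of _ cmod] arg_min_if_finite(1)[OF fin ne, of cmod] by (metis Diff_iff singletonD singletonI)
  define d where "d = cmod z2"
  have d: "d > 0" "d \<le> ?r v" using z2 spectral_radius_ge by (auto simp: d_def)
  \<comment> \<open>The first bound keeps the eigenvalue near \<open>z2\<close> away from zero; the second makes the upper estimate
    for the spectral radius smaller than \<open>\<eta>\<close>.\<close>
  define \<epsilon> where "\<epsilon> = min (d / 2) (\<eta> * d / (2 * ?r v))"
  have \<epsilon>: "\<epsilon> > 0" "\<epsilon> < d" using d \<eta> by (auto simp: \<epsilon>_def)
  have \<epsilon>r: "\<epsilon> * ?r v \<le> \<eta> * d / 2"
  proof -
    have "\<epsilon> * ?r v \<le> (\<eta> * d / (2 * ?r v)) * ?r v"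
      using d by (intro mult_right_mono) (auto simp: \<epsilon>_def)
    then show ?thesis using d by simp
  qed
  have \<epsilon>\<eta>: "\<epsilon> < \<eta>"
  proof -
    have "\<epsilon> * d \<le> \<epsilon> * ?r v" using d \<epsilon> by (intro mult_left_mono) auto
    also have "\<dots> \<le> (\<eta> / 2) * d" using \<epsilon>r by simp
    finally show ?thesis using d(1) \<eta> by simp
  qed
  have ev: "\<forall>\<^sub>F w in at v within S. cmod (poly (lin_char_poly (F w)) z) < \<epsilon> ^ DIM('a)" if "z \<in> Spec (F v)" for z
  proof -
    have "((\<lambda>w. poly (lin_char_poly (F w)) z) \<longlongrightarrow> poly (lin_char_poly (F v)) z) (at v within S)"
      using continuous_on_char_poly[OF F continuous_on_const[of S z]] v by (simp add: continuous_on_def)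
    then have "((\<lambda>w. poly (lin_char_poly (F w)) z) \<longlongrightarrow> 0) (at v within S)"
      using that by (simp add: Spec_def)
    then show ?thesis
      using tendstoD[of _ 0 _ "\<epsilon> ^ DIM('a)"] \<epsilon>(1) by fastforce
  qed
  have evS: "\<forall>\<^sub>F w in at v within S. w \<in> S"
    by (simp add: eventually_at_filter)
  show "\<forall>\<^sub>F w in at v within S. dist (?r w) (?r v) < \<eta>"
    using ev[OF z1(1)] ev[OF z2(1)] evS
  proof eventually_elim
    case (elim w)
    obtain s where s: "s \<noteq> 0" "Spec (F w) = (\<lambda>z. complex_of_real s * z) ` Spec (F v)"
      using proportional[OF elim(3) v] by blast
    have rw: "?r w = \<bar>s\<bar> * ?r v"
      by (rule spectral_radius_proportional[OF s(2)])
    obtain w1 where w1: "w1 \<in> Spec (F w)" "cmod (z1 - w1) < \<epsilon>"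
      using near_eigenvalue[OF elim(1) \<epsilon>(1)] by blast
    have "?r v \<le> cmod w1 + cmod (z1 - w1)"
      using norm_triangle_ineq[of w1 "z1 - w1"] z1 by simp
    also have "\<dots> < ?r w + \<epsilon>"
      using w1 spectral_radius_ge[OF w1(1)] by simp
    finally have lower: "?r v < ?r w + \<epsilon>" .
    obtain w2 where w2: "w2 \<in> Spec (F w)" "cmod (z2 - w2) < \<epsilon>"
      using near_eigenvalue[OF elim(2) \<epsilon>(1)] by blast
    then obtain y where y: "y \<in> Spec (F v)" "w2 = complex_of_real s * y"
      using s(2) by auto
    have "w2 \<noteq> 0" using w2 \<epsilon>(2) by (auto simp: d_def)
    then have "d \<le> cmod y" using z2(3)[OF y(1)] y by (auto simp: d_def)
    then have "\<bar>s\<bar> * d \<le> cmod w2" by (simp add: y norm_mult mult_left_mono)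
    also have "\<dots> < d + \<epsilon>"
      using norm_triangle_ineq[of z2 "w2 - z2"] w2 by (simp add: d_def norm_minus_commute)
    finally have "\<bar>s\<bar> * d * ?r v < (d + \<epsilon>) * ?r v"
      using d by (intro mult_strict_right_mono) auto
    then have "?r w * d < d * ?r v + \<epsilon> * ?r v" by (simp add: rw algebra_simps)
    also have "\<dots> \<le> d * ?r v + \<eta> * d / 2" using \<epsilon>r by simp
    also have "\<dots> = (?r v + \<eta> / 2) * d" by (simp add: algebra_simps)
    finally have "?r w < ?r v + \<eta> / 2" using d(1) by simp
    with lower \<epsilon>\<eta> \<eta> show ?case by (simp add: dist_real_def)
  qed
qed

text \<open>
  The factor is known up to its sign. The points where the sign may be taken positive and those where
  it may be taken negative form two closed sets that cover \<open>S\<close>. If they are disjoint, connectedness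
  leaves only the one containing \<open>e\<close>; a common point makes the
  spectrum invariant under negation.
\<close>

lemma Spec_scaled_by_spectral_radius:
  assumes v: "v \<in> S"
  shows "Spec (F v) = (\<lambda>z. complex_of_real (spectral_radius_of (F v) / spectral_radius_of (F e)) * z) ` Spec (F e)"
proof -
  define c where "c = (\<lambda>v. spectral_radius_of (F v) / spectral_radius_of (F e))"
  define \<Sigma> where "\<Sigma> = Spec (F e)"
  have c0: "c v > 0" if "v \<in> S" for v
    using spectral_radius_positive that e by (simp add: c_def)
  have cont_c: "continuous_on S c"
    unfolding c_def using spectral_radius_positive[OF e]
    by (intro continuous_intros spectral_radius_continuous) simp
  have two: "Spec (F v) = (\<lambda>z. complex_of_real (c v) * z) ` \<Sigma> \<or> Spec (F v) = (\<lambda>z. complex_of_real (- c v) * z) ` \<Sigma>"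
    if v: "v \<in> S" for v
  proof -
    obtain s where s: "Spec (F v) = (\<lambda>z. complex_of_real s * z) ` \<Sigma>"
      using proportional[OF v e] by (auto simp: \<Sigma>_def)
    have "c v = \<bar>s\<bar>"
      using spectral_radius_proportional[OF s[unfolded \<Sigma>_def]] spectral_radius_positive[OF e] by (simp add: c_def)
    then have "s = c v \<or> s = - c v" by auto
    then show ?thesis using s by auto
  qed
  \<comment> \<open>The points where the sign of the factor may be taken to be \<open>\<sigma>\<close>. Membership is expressed by the
    vanishing of a continuous function, which makes these sets closed.\<close>
  define E where "E = (\<lambda>\<sigma>::real. {v \<in> S. \<forall>z\<in>\<Sigma>. complex_of_real (\<sigma> * c v) * z \<in> Spec (F v)})"
  have E_iff: "v \<in> E \<sigma> \<longleftrightarrow> Spec (F v) = (\<lambda>z. complex_of_real (\<sigma> * c v) * z) ` \<Sigma>"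
    if v: "v \<in> S" and \<sigma>: "\<sigma> = 1 \<or> \<sigma> = -1" for v \<sigma>
  proof
    assume "v \<in> E \<sigma>"
    then have sub: "(\<lambda>z. complex_of_real (\<sigma> * c v) * z) ` \<Sigma> \<subseteq> Spec (F v)"
      by (auto simp: E_def)
    have card: "card ((\<lambda>z. complex_of_real t * z) ` \<Sigma>) = card \<Sigma>" if "t \<noteq> 0" for t
      using that by (intro card_image) (auto simp: inj_on_def)
    have "card (Spec (F v)) = card \<Sigma>"
      using two[OF v] card[of "c v"] card[of "- c v"] c0[OF v] by auto
    then have "card ((\<lambda>z. complex_of_real (\<sigma> * c v) * z) ` \<Sigma>) = card (Spec (F v))"
      using card[of "\<sigma> * c v"] c0[OF v] \<sigma> by auto
    then show "Spec (F v) = (\<lambda>z. complex_of_real (\<sigma> * c v) * z) ` \<Sigma>"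
      using card_subset_eq[OF finite_Spec sub] by simp
  qed (use v in \<open>auto simp: E_def\<close>)
  have closedE: "closedin (top_of_set S) (E \<sigma>)" for \<sigma>
  proof -
    have "E \<sigma> = (\<Inter>z\<in>\<Sigma>. {v \<in> S. poly (lin_char_poly (F v)) (complex_of_real (\<sigma> * c v) * z) = 0})"
      using Spec_nonempty[of "F e"] by (auto simp: E_def Spec_def \<Sigma>_def)
    moreover have "closedin (top_of_set S) {v \<in> S. poly (lin_char_poly (F v)) (complex_of_real (\<sigma> * c v) * z) = 0}" for z
      by (intro continuous_closedin_preimage_constant continuous_on_char_poly[OF F] continuous_intros cont_c)
    ultimately show ?thesis
      using Spec_nonempty[of "F e"] by (auto simp: \<Sigma>_def intro!: closedin_INT)
  qed
  have cover: "S \<subseteq> E 1 \<union> E (-1)"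
  proof
    fix v assume v: "v \<in> S"
    show "v \<in> E 1 \<union> E (-1)"
      using two[OF v] E_iff[OF v, of 1] E_iff[OF v, of "-1"] by auto
  qed
  have eE: "e \<in> E 1"
    using e spectral_radius_positive[OF e] by (simp add: E_def c_def \<Sigma>_def)
  have "v \<in> E 1"
  proof (cases "E 1 \<inter> E (-1) = {}")
    case True
    then have "E (-1) = {}"
      using S closedE[of 1] closedE[of "-1"] cover eE unfolding connected_closedin by blast
    then show ?thesis using cover v by auto
  next
    case False
    then obtain u where u: "u \<in> E 1" "u \<in> E (-1)" by auto
    then have uS: "u \<in> S" by (simp add: E_def)
    have eq: "(\<lambda>z. complex_of_real (c u) * z) ` \<Sigma> = (\<lambda>z. complex_of_real (- c u) * z) ` \<Sigma>"
      using u E_iff[OF uS, of 1] E_iff[OF uS, of "-1"] by simp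
    have sym: "- z \<in> \<Sigma>" if "z \<in> \<Sigma>" for z
    proof -
      have "complex_of_real (c u) * z \<in> (\<lambda>z. complex_of_real (- c u) * z) ` \<Sigma>"
        using that eq by blast
      then obtain y where "y \<in> \<Sigma>" "complex_of_real (c u) * z = complex_of_real (c u) * (- y)" by auto
      then have "z = - y" using c0[OF uS] by (metis less_irrefl mult_left_cancel of_real_eq_0_iff)
      then show ?thesis using \<open>y \<in> \<Sigma>\<close> by simp
    qed
    have "(\<lambda>z. complex_of_real (- c v) * z) ` \<Sigma> = (\<lambda>z. complex_of_real (c v) * z) ` \<Sigma>"
    proof (intro equalityI image_subsetI)
      fix z assume "z \<in> \<Sigma>"
      then show "complex_of_real (- c v) * z \<in> (\<lambda>z. complex_of_real (c v) * z) ` \<Sigma>"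
        "complex_of_real (c v) * z \<in> (\<lambda>z. complex_of_real (- c v) * z) ` \<Sigma>"
        using sym[of z] by (auto intro: image_eqI[of _ _ "- z"])
    qed
    then show ?thesis using two[OF v] E_iff[OF v, of 1] by auto
  qed
  then show ?thesis
    using E_iff[OF v, of 1] by (simp add: c_def \<Sigma>_def)
qed

end

lemma eigenpair_in_kernel:
  assumes "eigenpair T z x y" "T x = 0" "T y = 0"
  shows "z = 0"
proof -
  have 1: "Re z *\<^sub>R x - Im z *\<^sub>R y = 0" and 2: "Im z *\<^sub>R x + Re z *\<^sub>R y = 0" and ne: "x \<noteq> 0 \<or> y \<noteq> 0"
    using assms by (auto simp: eigenpair_def)
  have "((Re z)\<^sup>2 + (Im z)\<^sup>2) *\<^sub>R x = Re z *\<^sub>R (Re z *\<^sub>R x - Im z *\<^sub>R y) + Im z *\<^sub>R (Im z *\<^sub>R x + Re z *\<^sub>R y)"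
    "((Re z)\<^sup>2 + (Im z)\<^sup>2) *\<^sub>R y = Re z *\<^sub>R (Im z *\<^sub>R x + Re z *\<^sub>R y) - Im z *\<^sub>R (Re z *\<^sub>R x - Im z *\<^sub>R y)"
    by (simp_all add: algebra_simps power2_eq_square)
  then have "(Re z)\<^sup>2 + (Im z)\<^sup>2 = 0" using ne by (auto simp: 1 2)
  then show ?thesis by (simp add: complex_eq_iff sum_power2_eq_zero_iff)
qed

text \<open>
  Here the topology is applied. The constant spectrum provides polynomials that work for all \<open>v\<close> at
  once: \<open>p\<close> gives the projections \<open>P v\<close> for the pair \<open>l, cnj l\<close>, and if \<open>l\<close> is not real, \<open>j p\<close> gives
  complex structures. The operators live on the whole space and not on \<open>v\<^sup>\<bottom>\<close>; this is repaired by
  following them with \<open>tangent_part v\<close>, as polynomials without constant term annihilate \<open>v\<close>.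
\<close>

lemma tangent_family_spectrum:
  fixes T :: "'a::euclidean_space \<Rightarrow> 'a \<Rightarrow> 'a"
  assumes odd: "odd DIM('a)" and dim: "DIM('a) \<ge> 2" and T: "linear_family (sphere 0 1) T"
    and normal: "\<And>v. norm v = 1 \<Longrightarrow> T v v = 0"
    and antipodal: "\<And>v. norm v = 1 \<Longrightarrow> T (- v) = T v"
    and spec: "\<And>v. norm v = 1 \<Longrightarrow> Spec (T v) = \<Sigma>"
    and l: "l \<in> \<Sigma>" "l \<noteq> 0"
  shows "Im l = 0" and "\<Sigma> = {0, l}" and "norm v = 1 \<Longrightarrow> lin_trace (T v) = (real DIM('a) - 1) * Re l"
proof -
  let ?m = "DIM('a)"
  obtain e0 :: 'a where e0: "norm e0 = 1"
    using nonempty_Basis norm_Basis by blast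
  have linT: "linear (T v)" if "norm v = 1" for v
    using linear_familyD(1)[OF T] that by simp
  have fin: "finite \<Sigma>" using spec[OF e0] finite_Spec by metis
  have "e0 \<noteq> 0" using e0 by auto
  then have "0 \<in> \<Sigma>"
    using zero_in_Spec_iff[OF linT[OF e0]] normal[OF e0] spec[OF e0] by blast
  define A where "A = {l, cnj l}"
  define B where "B = \<Sigma> - A"
  have finAB: "finite A" "finite B" using fin by (simp_all add: A_def B_def)
  have zeroB: "0 \<in> B" using \<open>0 \<in> \<Sigma>\<close> l by (auto simp: A_def B_def)
  define g where "g = (\<Prod>z\<in>A. conj_quadratic z) ^ ?m"
  define h where "h = (\<Prod>z\<in>B. conj_quadratic z) ^ ?m"
  obtain u w where bezout: "u * g + w * h = 1"
    unfolding g_def h_def by (rule splitting_polynomials[of A B]) (auto simp: A_def B_def)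
  have gh: "poly_op (g * h) (T v) x = 0" if v: "norm v = 1" for v x
  proof -
    have "g * h = (\<Prod>z\<in>A \<union> B. conj_quadratic z) ^ ?m"
      unfolding g_def h_def power_mult_distrib[symmetric] using finAB
      by (subst prod.union_disjoint) (auto simp: B_def)
    then show ?thesis
      using annihilator_from_spectrum[OF linT[OF v], of "A \<union> B"] finAB spec[OF v] by (auto simp: B_def)
  qed
  define p where "p = w * h"
  have g_dvd: "conj_quadratic l dvd g" and h_dvd: "z \<in> B \<Longrightarrow> conj_quadratic z dvd h" for z
    unfolding g_def h_def using finAB DIM_positive[where 'a='a]
    by (auto simp: A_def intro!: dvd_power dvd_prodI dvd_trans[OF dvd_prodI dvd_power])
  have h0: "poly h 0 = 0"
    using h_dvd[OF zeroB] by (auto simp: conj_quadratic_def dvd_def)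
  then have p0: "poly p 0 = 0" by (simp add: p_def)
  define P where "P = (\<lambda>v. poly_op p (T v))"
  have P_fix: "P v x = x" if v: "norm v = 1" and "poly_op g (T v) x = 0" for v x
  proof -
    have "poly_op (u * g + w * h) (T v) x = x" by (simp add: bezout)
    then show ?thesis
      using that(2) by (simp add: poly_op_add poly_op_mult[OF linT[OF v]] poly_op_zero_arg[OF linT[OF v]] P_def p_def)
  qed
  have gP: "poly_op g (T v) (P v x) = 0" if v: "norm v = 1" for v x
  proof -
    have "poly_op g (T v) (P v x) = poly_op (w * (g * h)) (T v) x"
      by (simp add: P_def p_def poly_op_mult[OF linT[OF v], symmetric] mult.left_commute)
    then show ?thesis using gh[OF v] by (simp add: poly_op_mult[OF linT[OF v], of w] poly_op_zero_arg[OF linT[OF v]])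
  qed
  have P_kernel: "P v x = 0" if v: "norm v = 1" and "poly_op h (T v) x = 0" for v x
    using that by (simp add: P_def p_def poly_op_mult[OF linT[OF v]] poly_op_zero_arg[OF linT[OF v]])
  have Pv: "P v v = 0" if "norm v = 1" for v
    unfolding P_def using poly_op_kernel[OF linT[OF that] normal[OF that]] p0 by simp
  have linP: "linear (P v)" if "norm v = 1" for v
    unfolding P_def by (rule linear_poly_op[OF linT[OF that]])
  have P_tan: "P v (tangent_part v x) = P v x" if "norm v = 1" for v x
    using Pv[OF that] by (simp add: tangent_part_def linear_diff[OF linP[OF that]] linear_scale[OF linP[OF that]])
  have tan0: "x = (v \<bullet> x) *\<^sub>R v" if "tangent_part v x = 0" for v x :: 'a
    using that by (simp add: tangent_part_def)
  have T_normal: "T v x = 0" if v: "norm v = 1" and "tangent_part v x = 0" for v x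
    using tan0[OF that(2)] normal[OF v] by (metis linear_scale[OF linT[OF v]] scaleR_zero_right)
  \<comment> \<open>\<open>P v\<close> induces the identity on the tangent space, as the tangent bundle does not split.\<close>
  have RP: "tangent_part v (P v x) = tangent_part v x" if v: "norm v = 1" for v x
  proof (rule tangent_projection_trivial[OF odd _ _ _ _ _ v])
    show "linear_family (sphere 0 1) (\<lambda>v x. tangent_part v (P v x))"
      unfolding P_def by (intro linear_family_compose[OF linear_family_tangent_part linear_family_poly_op[OF T]])
    fix v x assume v: "norm (v::'a) = 1"
    show "tangent_part v (P v (tangent_part v (P v x))) = tangent_part v (P v x)"
      by (simp add: P_tan[OF v] P_fix[OF v gP[OF v]])
    show "tangent_part v (P v v) = 0"
      using Pv[OF v] by (simp add: tangent_part_def)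
    show "v \<bullet> tangent_part v (P v x) = 0" by (rule tangent_part_inner[OF v])
    obtain x y where xy: "eigenpair (T v) l x y"
      using l(1) spec[OF v] Spec_iff_eigenpair[OF linT[OF v]] by blast
    have Pxy: "P v x = x" "P v y = y"
      using conj_quadratic_eigenpair[OF linT[OF v] xy] poly_op_dvd[OF linT[OF v] g_dvd] P_fix[OF v] by auto
    show "\<exists>x. tangent_part v (P v x) \<noteq> 0"
    proof (rule ccontr)
      assume "\<not> ?thesis"
      then have "T v x = 0" "T v y = 0" using T_normal[OF v] Pxy by metis+
      then show False using eigenpair_in_kernel[OF xy] l(2) by simp
    qed
  qed
  have tan_scale: "tangent_part v (c *\<^sub>R v) = 0" if "norm v = 1" for v :: 'a and c
    using that by (simp add: tangent_part_def dot_square_norm)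
  \<comment> \<open>Hence the complementary generalised eigenspace is the line of \<open>v\<close>.\<close>
  have complement: "\<exists>c. x = P v x + c *\<^sub>R v" if v: "norm v = 1" for v x
  proof -
    have "tangent_part v (x - P v x) = 0"
      by (simp add: linear_diff[OF linear_tangent_part] RP[OF v])
    from tan0[OF this] show ?thesis by (metis add.commute diff_add_cancel)
  qed
  have kernel_h: "tangent_part v x = 0" if v: "norm v = 1" and "poly_op h (T v) x = 0" for v x
    using RP[OF v, of x] P_kernel[OF v that(2)] by (simp add: linear_0[OF linear_tangent_part])
  \<comment> \<open>An eigenvector for any further eigenvalue is annihilated by \<open>P v\<close> and is therefore radial.\<close>
  have sub: "\<Sigma> \<subseteq> {0} \<union> A"
  proof
    fix z assume z: "z \<in> \<Sigma>"
    show "z \<in> {0} \<union> A"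
    proof (rule ccontr)
      assume nz: "z \<notin> {0} \<union> A"
      then have "z \<in> B" using z by (simp add: B_def)
      obtain x y where xy: "eigenpair (T e0) z x y"
        using z spec[OF e0] Spec_iff_eigenpair[OF linT[OF e0]] by blast
      have "poly_op h (T e0) x = 0" "poly_op h (T e0) y = 0"
        using conj_quadratic_eigenpair[OF linT[OF e0] xy] poly_op_dvd[OF linT[OF e0] h_dvd[OF \<open>z \<in> B\<close>]] by auto
      then have "T e0 x = 0" "T e0 y = 0"
        using kernel_h[OF e0] T_normal[OF e0] by auto
      then show False using eigenpair_in_kernel[OF xy] nz by simp
    qed
  qed
  show Im: "Im l = 0"
  proof (rule ccontr)
    assume Im: "Im l \<noteq> 0"
    have "conj_quadratic (cnj l) = conj_quadratic l" by (simp add: conj_quadratic_def)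
    moreover have "l \<noteq> cnj l" using Im by (simp add: complex_eq_iff)
    ultimately have g_eq: "g = conj_quadratic l ^ (2 * ?m)"
      by (simp add: g_def A_def power_mult power2_eq_square)
    obtain j where j: "g dvd j * j + 1"
      using complex_structure_polynomial[OF Im, of "2 * ?m"] g_eq by auto
    have "g dvd (j * p) * (j * p) + 1"
    proof -
      have "(j * p) * (j * p) + 1 = (j * j + 1) * (p * p) + u * g * (1 + p)"
      proof -
        have "u * g = 1 - p" using bezout by (simp add: p_def algebra_simps)
        then show ?thesis by (simp only:) (simp add: algebra_simps)
      qed
      then show ?thesis using j by simp
    qed
    then obtain r where r: "(j * p) * (j * p) + 1 = r * g" by (auto simp: dvd_def mult.commute)
    \<comment> \<open>On the image of \<open>P v\<close> the operator \<open>W v\<close> squares to \<open>-1\<close>, and it annihilates \<open>v\<close>.\<close>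
    define W where "W = (\<lambda>v. poly_op (j * p) (T v))"
    have linW: "linear (W v)" if "norm v = 1" for v
      unfolding W_def by (rule linear_poly_op[OF linT[OF that]])
    have Wv: "W v v = 0" if "norm v = 1" for v
      unfolding W_def using poly_op_kernel[OF linT[OF that] normal[OF that]] p0 by simp
    have W_tan: "W v (tangent_part v x) = W v x" if "norm v = 1" for v x
      using Wv[OF that] by (simp add: tangent_part_def linear_diff[OF linW[OF that]] linear_scale[OF linW[OF that]])
    show False
    proof (rule no_antipodal_complex_structure[OF odd dim])
      show "linear_family (sphere 0 1) (\<lambda>v x. tangent_part v (W v x))"
        unfolding W_def by (intro linear_family_compose[OF linear_family_tangent_part linear_family_poly_op[OF T]])
      fix v x :: 'a assume v: "norm v = 1"
      show "tangent_part v (W v v) = 0" using Wv[OF v] by (simp add: tangent_part_def)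
      show "tangent_part (- v) (W (- v) x) = tangent_part v (W v x)"
        by (simp add: tangent_part_uminus W_def antipodal[OF v])
      have "tangent_part v (W v (tangent_part v (W v x))) = tangent_part v (poly_op (r * g - 1) (T v) x)"
        by (simp add: W_tan[OF v] r[symmetric]) (simp add: W_def poly_op_mult[OF linT[OF v]])
      also have "\<dots> = tangent_part v (poly_op r (T v) (poly_op g (T v) x)) - tangent_part v x"
        by (simp add: poly_op_diff poly_op_mult[OF linT[OF v]] linear_diff[OF linear_tangent_part])
      also have "tangent_part v (poly_op r (T v) (poly_op g (T v) x)) = 0"
      proof -
        have lin: "linear (poly_op q (T v))" for q by (rule linear_poly_op[OF linT[OF v]])
        obtain c where c: "x = P v x + c *\<^sub>R v" using complement[OF v] by blast
        have "poly_op g (T v) x = poly_op g (T v) (P v x) + c *\<^sub>R poly_op g (T v) v"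
          by (subst c) (simp add: linear_add[OF lin] linear_scale[OF lin])
        also have "\<dots> = (c * poly g 0) *\<^sub>R v"
          by (simp add: gP[OF v] poly_op_kernel[OF linT[OF v] normal[OF v]])
        finally show ?thesis
          by (simp add: linear_scale[OF lin] poly_op_kernel[OF linT[OF v] normal[OF v]] tan_scale[OF v])
      qed
      finally show "tangent_part v (W v (tangent_part v (W v x))) = - tangent_part v x" by simp
    qed
  qed
  then have "cnj l = l" by (simp add: complex_eq_iff)
  then show \<Sigma>: "\<Sigma> = {0, l}"
    using sub l \<open>0 \<in> \<Sigma>\<close> by (auto simp: A_def)
  assume v: "norm v = 1"
  \<comment> \<open>The operator induced by \<open>T v - l\<close> on the tangent space is nilpotent: it has no eigenvalue \<open>z \<noteq> 0\<close>,
    since \<open>z + l\<close> would be an eigenvalue of \<open>T v\<close> on the quotient by \<open>v\<close>. Its vanishing trace gives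
    the trace of \<open>T v\<close>.\<close>
  define K where "K = (\<lambda>x. tangent_part v (T v x) - Re l *\<^sub>R tangent_part v x)"
  have linK: "linear K"
    unfolding K_def
    by (intro linear_compose_sub linear_compose_scale_right linear_tangent_part
        linear_compose[OF linT[OF v] linear_tangent_part, unfolded o_def])
  have "Spec K \<subseteq> {0}"
  proof
    fix z assume "z \<in> Spec K"
    then obtain x y where xy: "eigenpair K z x y"
      using Spec_iff_eigenpair[OF linK] by blast
    show "z \<in> {0}"
    proof (rule ccontr)
      assume z: "z \<notin> {0}"
      then have z2: "(Re z)\<^sup>2 + (Im z)\<^sup>2 \<noteq> 0" by (simp add: complex_eq_iff sum_power2_eq_zero_iff)
      have Kx: "K x = Re z *\<^sub>R x - Im z *\<^sub>R y" and Ky: "K y = Im z *\<^sub>R x + Re z *\<^sub>R y"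
        using xy by (simp_all add: eigenpair_def)
      have vK: "v \<bullet> K x = 0" for x
        using v by (simp add: K_def inner_diff_right tangent_part_inner)
      have 1: "Re z * (v \<bullet> x) - Im z * (v \<bullet> y) = 0" and 2: "Im z * (v \<bullet> x) + Re z * (v \<bullet> y) = 0"
        using vK[of x] vK[of y] by (simp_all add: Kx Ky inner_diff_right inner_add_right)
      have "((Re z)\<^sup>2 + (Im z)\<^sup>2) * (v \<bullet> x) =
          Re z * (Re z * (v \<bullet> x) - Im z * (v \<bullet> y)) + Im z * (Im z * (v \<bullet> x) + Re z * (v \<bullet> y))"
        by (simp add: algebra_simps power2_eq_square)
      then have "((Re z)\<^sup>2 + (Im z)\<^sup>2) * (v \<bullet> x) = 0"
        unfolding 1 2 by (simp only: mult_zero_right add_0_right diff_self)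
      then have "v \<bullet> x = 0" using z2 by (metis mult_eq_0_iff)
      moreover have "((Re z)\<^sup>2 + (Im z)\<^sup>2) * (v \<bullet> y) =
          Re z * (Im z * (v \<bullet> x) + Re z * (v \<bullet> y)) - Im z * (Re z * (v \<bullet> x) - Im z * (v \<bullet> y))"
        by (simp add: algebra_simps power2_eq_square)
      then have "((Re z)\<^sup>2 + (Im z)\<^sup>2) * (v \<bullet> y) = 0"
        unfolding 1 2 by (simp only: mult_zero_right add_0_right diff_self)
      then have "v \<bullet> y = 0" using z2 by (metis mult_eq_0_iff)
      ultimately have "v \<bullet> x = 0" "v \<bullet> y = 0" by auto
      then have tx: "tangent_part v x = x" and ty: "tangent_part v y = y"
        by (simp_all add: tangent_part_def)
      define z' where "z' = z + l"
      have tTx: "tangent_part v (T v x) = Re z' *\<^sub>R x - Im z' *\<^sub>R y"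
        and tTy: "tangent_part v (T v y) = Im z' *\<^sub>R x + Re z' *\<^sub>R y"
        using Kx Ky by (simp_all add: K_def tx ty z'_def Im algebra_simps)
      have T_tan: "T v (tangent_part v u) = T v u" for u
        using normal[OF v] by (simp add: tangent_part_def linear_diff[OF linT[OF v]] linear_scale[OF linT[OF v]])
      have TTx: "T v (T v x) = Re z' *\<^sub>R T v x - Im z' *\<^sub>R T v y"
        and TTy: "T v (T v y) = Im z' *\<^sub>R T v x + Re z' *\<^sub>R T v y"
        using arg_cong[OF tTx, of "T v"] arg_cong[OF tTy, of "T v"]
        by (simp_all add: T_tan linear_add[OF linT[OF v]] linear_diff[OF linT[OF v]] linear_scale[OF linT[OF v]])
      \<comment> \<open>Apply \<open>T v\<close> to get rid of the radial components of \<open>T v x\<close> and \<open>T v y\<close>.\<close>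
      have "z' = 0"
      proof (cases "T v x = 0 \<and> T v y = 0")
        case True
        have "eigenpair (\<lambda>x. 0) z' x y"
          using xy tTx tTy True by (simp add: eigenpair_def tangent_part_def)
        then show ?thesis by (rule eigenpair_in_kernel) simp_all
      next
        case False
        then have "eigenpair (T v) z' (T v x) (T v y)"
          using TTx TTy by (auto simp: eigenpair_def)
        then have "z' \<in> {0, l}"
          using Spec_iff_eigenpair[OF linT[OF v]] spec[OF v] \<Sigma> by blast
        then show ?thesis using z by (auto simp: z'_def)
      qed
      then have "T v (T v x) = 0" "T v (T v y) = 0" using TTx TTy by simp_all
      then have "poly_op (conj_quadratic 0) (T v) x = 0" "poly_op (conj_quadratic 0) (T v) y = 0"
        by (simp_all add: poly_op_conj_quadratic[OF linT[OF v]])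
      then have "tangent_part v x = 0" "tangent_part v y = 0"
        using kernel_h[OF v] poly_op_dvd[OF linT[OF v] h_dvd[OF zeroB]] by auto
      then show False using xy tx ty by (simp add: eigenpair_def)
    qed
  qed
  then have "lin_trace K = 0" by (rule trace_of_nilpotent)
  moreover have "lin_trace K = lin_trace (T v) - (real DIM('a) - 1) * Re l"
  proof -
    have 1: "(\<Sum>b\<in>Basis. (v \<bullet> T v b) * (v \<bullet> b)) = 0"
    proof -
      have "(\<Sum>b\<in>Basis. (v \<bullet> T v b) * (v \<bullet> b)) = v \<bullet> T v v"
        using arg_cong[OF linear_basis_expansion[OF linT[OF v], of v], of "inner v"]
        by (simp add: inner_sum_right mult.commute)
      then show ?thesis using normal[OF v] by simp
    qed
    have 2: "(\<Sum>b\<in>Basis. (v \<bullet> b) * (v \<bullet> b)) = 1"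
      using euclidean_inner[of v v] v by (simp add: dot_square_norm)
    have "lin_trace K = (\<Sum>b\<in>Basis. (T v b \<bullet> b - (v \<bullet> T v b) * (v \<bullet> b)) - Re l * (1 - (v \<bullet> b) * (v \<bullet> b)))"
      unfolding lin_trace_def
      by (intro sum.cong refl) (simp add: K_def tangent_part_def inner_diff_left)
    also have "\<dots> = (lin_trace (T v) - (\<Sum>b\<in>Basis. (v \<bullet> T v b) * (v \<bullet> b))) - Re l * (real DIM('a) - (\<Sum>b\<in>Basis. (v \<bullet> b) * (v \<bullet> b)))"
      by (simp only: sum_subtractf sum_distrib_left[symmetric] lin_trace_def) simp
    finally show ?thesis unfolding 1 2 by (simp add: mult.commute)
  qed
  ultimately show "lin_trace (T v) = (real DIM('a) - 1) * Re l" by simp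
qed

section \<open>The Ricci form and the Jacobi operators\<close>

lemma Ck_on_const: "Ck_on n (\<lambda>x. c) S"
  by (induction n arbitrary: c) (simp_all add: frechet_derivative_const)

text \<open>
  The first derivatives are linear and the second ones constant.
\<close>

lemma smooth_on_quadratic:
  fixes B :: "'a::euclidean_space \<Rightarrow> 'a \<Rightarrow> real"
  assumes B: "bilinear B"
  shows "smooth_on (\<lambda>x. B x x) S"
proof -
  have bb: "bounded_bilinear B"
    using B by (simp add: bilinear_conv_bounded_bilinear)
  have linear: "Ck_on n l S" if "linear l" for n and l :: "'a \<Rightarrow> real"
  proof (cases n)
    case 0
    then show ?thesis using linear_continuous_on[of l S] that by (simp add: linear_conv_bounded_linear)
  next
    case (Suc k)
    have der: "(l has_derivative l) (at x)" for x
      using that by (simp add: bounded_linear_imp_has_derivative linear_conv_bounded_linear)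
    have "l differentiable (at x)" "frechet_derivative l (at x) = l" for x
      using differentiableI[OF der] frechet_derivative_at[OF der, symmetric] by simp_all
    then show ?thesis by (simp add: Suc Ck_on_const)
  qed
  have "Ck_on n (\<lambda>x. B x x) S" for n
  proof (cases n)
    case 0
    then show ?thesis
      using bounded_bilinear.continuous_on[OF bb continuous_on_id continuous_on_id] by simp
  next
    case (Suc k)
    have der: "((\<lambda>x. B x x) has_derivative (\<lambda>h. B x h + B h x)) (at x)" for x
      by (rule bounded_bilinear.FDERIV[OF bb has_derivative_ident has_derivative_ident])
    have "(\<lambda>x. B x x) differentiable (at x)"
      and "frechet_derivative (\<lambda>x. B x x) (at x) = (\<lambda>h. B x h + B h x)" for x
      using differentiableI[OF der] frechet_derivative_at[OF der, symmetric] by simp_all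
    moreover have "linear (\<lambda>x. B x h + B h x)" for h
      using linear_compose_add[of "\<lambda>x. B x h" "B h"] B by (simp only: bilinear_def)
    ultimately show ?thesis
      using linear[of "\<lambda>x. B x h + B h x" k for h] by (simp only: Suc Ck_on.simps) blast
  qed
  then show ?thesis by (simp add: smooth_on_def)
qed

lemma bilinear_Ricci:
  fixes A :: "'a::euclidean_space \<Rightarrow> 'a \<Rightarrow> 'a \<Rightarrow> 'a"
  assumes "affine_curvature_model A"
  shows "bilinear (Ricci A)"
proof -
  have inner: "linear (\<lambda>x. f x \<bullet> b)" if "linear f" for f :: "'a \<Rightarrow> 'a" and b
    using that by (intro linearI) (simp_all add: linear_add linear_scale inner_add_left)
  have "linear (A b x)" "linear (\<lambda>x. A b x y)" for b x y
    using assms unfolding affine_curvature_model_def bilinear_def by blast+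
  then show ?thesis
    unfolding bilinear_def Ricci_def lin_trace_def
    by (auto intro!: linear_compose_sum inner)
qed

lemma Ricci_diagonal: "Ricci A v v = lin_trace (Jacobi_op A v)"
  by (simp add: Ricci_def Jacobi_op_def[abs_def])

lemma lin_trace_scale: "lin_trace (\<lambda>x. c *\<^sub>R T x) = c * lin_trace T"
  by (simp add: lin_trace_def sum_distrib_left)

context
  fixes A :: "'a::euclidean_space \<Rightarrow> 'a \<Rightarrow> 'a \<Rightarrow> 'a"
  assumes A: "affine_curvature_model A"
begin

lemma curvature_linear: "linear (A x y)" "linear (\<lambda>x. A x y z)" "linear (\<lambda>y. A x y z)"
  using A unfolding affine_curvature_model_def bilinear_def by blast+

lemma linear_Jacobi: "linear (Jacobi_op A v)"
  unfolding Jacobi_op_def by (rule curvature_linear)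

lemma Jacobi_self: "Jacobi_op A v v = 0"
proof -
  have "A v v v = - A v v v" using A unfolding affine_curvature_model_def by blast
  then have "A v v v + A v v v = 0" by (metis add.right_inverse)
  then have "(2::real) *\<^sub>R A v v v = 0" by (simp only: scaleR_2)
  then show ?thesis by (simp add: Jacobi_op_def)
qed

lemma Jacobi_scale: "Jacobi_op A (c *\<^sub>R v) = (\<lambda>x. c\<^sup>2 *\<^sub>R Jacobi_op A v x)"
  by (simp add: Jacobi_op_def fun_eq_iff linear_scale[OF curvature_linear(1)]
      linear_scale[OF curvature_linear(3)] power2_eq_square)

lemma linear_family_Jacobi: "linear_family S (Jacobi_op A)"
proof -
  have "continuous_on S (\<lambda>v. A w v v)" for w
  proof -
    have "linear_family S (\<lambda>v. A w v)"
      unfolding linear_family_def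
      using curvature_linear linear_continuous_on[of "\<lambda>y. A w y z" S for z]
      by (simp add: linear_conv_bounded_linear)
    from linear_family_apply_continuous[OF this continuous_on_id] show ?thesis .
  qed
  then show ?thesis
    using linear_Jacobi by (simp add: linear_family_def Jacobi_op_def)
qed

end

text \<open>
  Dimension one is excluded because there \<open>J(v)\<close> vanishes on the span of \<open>v\<close>, so that its spectrum is
  \<open>{0}\<close>. In higher dimension the sphere is connected and the normalised operators satisfy the
  hypotheses of \<open>tangent_family_spectrum\<close>.
\<close>

lemma Osserman_unit_spectrum:
  fixes A :: "'a::euclidean_space \<Rightarrow> 'a \<Rightarrow> 'a \<Rightarrow> 'a"
  assumes osserman: "affine_projective_Osserman A" and odd: "odd DIM('a)" and v: "norm v = 1"
  obtains l where "l \<noteq> 0" "Spec (Jacobi_op A v) = {0, complex_of_real l}"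
    "lin_trace (Jacobi_op A v) = (real DIM('a) - 1) * l"
proof -
  have A: "affine_curvature_model A"
    by (rule osserman[unfolded affine_projective_Osserman_def, THEN conjunct1])
  have scaled: "\<exists>s::real. s \<noteq> 0 \<and>
      Spec (Jacobi_op A v) = (\<lambda>z. complex_of_real s * z) ` Spec (Jacobi_op A w) \<and>
      (\<lambda>z. complex_of_real s * z) ` Spec (Jacobi_op A w) \<noteq> {0}" if "v \<noteq> 0" "w \<noteq> 0" for v w
    using osserman[unfolded affine_projective_Osserman_def, THEN conjunct2, rule_format, OF that] .
  note linJ = linear_Jacobi[OF A] and Jv = Jacobi_self[OF A]
  have nontrivial: "\<exists>z\<in>Spec (Jacobi_op A v). z \<noteq> 0" if v: "v \<noteq> 0" for v
  proof -
    obtain s where s: "Spec (Jacobi_op A v) = (\<lambda>z. complex_of_real s * z) ` Spec (Jacobi_op A v)"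
      "(\<lambda>z. complex_of_real s * z) ` Spec (Jacobi_op A v) \<noteq> {0}"
      using scaled[OF v v] by (elim exE conjE)
    have "Spec (Jacobi_op A v) \<noteq> {0}" by (rule ssubst[OF s(1)]) (rule s(2))
    then have "\<not> Spec (Jacobi_op A v) \<subseteq> {0}"
      using Spec_nonempty[of "Jacobi_op A v"] by (simp add: subset_singleton_iff)
    then show ?thesis by blast
  qed
  have v0: "v \<noteq> 0" using v by auto
  have dim: "DIM('a) \<ge> 2"
  proof (rule ccontr)
    assume "\<not> 2 \<le> DIM('a)"
    then have "DIM('a) = 1" using DIM_positive[where 'a='a] by linarith
    obtain z x y where z: "z \<noteq> 0" and xy: "eigenpair (Jacobi_op A v) z x y"
    proof -
      obtain z where z: "z \<in> Spec (Jacobi_op A v)" "z \<noteq> 0" using nontrivial[OF v0] by (rule bexE)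
      from z(1) obtain x y where "eigenpair (Jacobi_op A v) z x y"
        unfolding Spec_iff_eigenpair[OF linJ] by (elim exE)
      with z(2) show thesis by (rule that)
    qed
    have "Jacobi_op A v x = 0" for x
    proof -
      have "span {v} = UNIV"
        using \<open>DIM('a) = 1\<close> v0 by (subst dim_eq_full[symmetric]) (simp add: dim_singleton)
      then have "x \<in> span {v}" by simp
      then obtain c where "x = c *\<^sub>R v" unfolding span_singleton by blast
      then show ?thesis by (simp add: linear_scale[OF linJ] Jv)
    qed
    then show False using eigenpair_in_kernel[OF xy] z by simp
  qed
  interpret proportional_spectra "sphere 0 1 :: 'a set" "Jacobi_op A" v
  proof
    show "linear_family (sphere 0 1) (Jacobi_op A)" by (rule linear_family_Jacobi[OF A])
    show "connected (sphere 0 1 :: 'a set)" by (rule connected_sphere[OF dim])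
    show "v \<in> sphere 0 1" using v by simp
    show "\<exists>s::real. s \<noteq> 0 \<and> Spec (Jacobi_op A u) = (\<lambda>z. complex_of_real s * z) ` Spec (Jacobi_op A w)"
      if "u \<in> sphere 0 1" "w \<in> sphere 0 1" for u w
    proof -
      have "u \<noteq> 0" "w \<noteq> 0" using that by auto
      from scaled[OF this] obtain s where
        "s \<noteq> 0" "Spec (Jacobi_op A u) = (\<lambda>z. complex_of_real s * z) ` Spec (Jacobi_op A w)"
        by (elim exE conjE)
      then show ?thesis by (intro exI conjI)
    qed
    show "\<exists>z\<in>Spec (Jacobi_op A w). z \<noteq> 0" if "w \<in> sphere 0 1" for w
    proof -
      have "w \<noteq> 0" using that by auto
      then show ?thesis by (rule nontrivial)
    qed
  qed
  let ?r = "\<lambda>w. spectral_radius_of (Jacobi_op A w)"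
  have r: "?r w > 0" if "norm w = 1" for w
    using spectral_radius_positive[of w] that by simp
  define T where "T = (\<lambda>w x. (1 / ?r w) *\<^sub>R Jacobi_op A w x)"
  define \<Sigma> where "\<Sigma> = (\<lambda>z. complex_of_real (1 / ?r v) * z) ` Spec (Jacobi_op A v)"
  have T: "linear_family (sphere 0 1) T"
    unfolding T_def
  proof (intro linear_family_scaleR linear_family_Jacobi[OF A] continuous_on_divide continuous_on_const
      spectral_radius_continuous ballI)
    show "?r w \<noteq> 0" if "w \<in> sphere 0 1" for w
      using r[of w] that by simp
  qed
  have spec: "Spec (T w) = \<Sigma>" if w: "norm w = 1" for w
  proof -
    have "Spec (T w) = (\<lambda>z. complex_of_real (1 / ?r w) * z) ` Spec (Jacobi_op A w)"
      unfolding T_def using Spec_scale[OF linJ, of "1 / ?r w"] r[OF w] by simp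
    also have "\<dots> = \<Sigma>"
    proof -
      have "w \<in> sphere 0 1" using w by simp
      from arg_cong[OF Spec_scaled_by_spectral_radius[OF this], of "image (\<lambda>z. complex_of_real (1 / ?r w) * z)"]
      have "(\<lambda>z. complex_of_real (1 / ?r w) * z) ` Spec (Jacobi_op A w) =
          (\<lambda>z. complex_of_real (1 / ?r w) * (complex_of_real (?r w / ?r v) * z)) ` Spec (Jacobi_op A v)"
        unfolding image_image .
      then show ?thesis using r[OF w] by (simp add: \<Sigma>_def)
    qed
    finally show ?thesis .
  qed
  obtain z where z: "z \<in> Spec (Jacobi_op A v)" "z \<noteq> 0" using nontrivial[OF v0] by blast
  define l where "l = complex_of_real (1 / ?r v) * z"
  have l: "l \<in> \<Sigma>" "l \<noteq> 0" using z r[OF v] by (auto simp: l_def \<Sigma>_def)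
  have normal: "T w w = 0" and antipodal: "T (- w) = T w" for w
    using Jacobi_scale[OF A, of "-1" w] by (simp_all add: T_def Jv)
  have facts: "Im l = 0" "\<Sigma> = {0, l}" "lin_trace (T v) = (real DIM('a) - 1) * Re l"
    by (rule tangent_family_spectrum[OF odd dim T, where \<Sigma>=\<Sigma>], rule normal, rule antipodal, erule spec, fact+)+
  have J: "Jacobi_op A v = (\<lambda>x. ?r v *\<^sub>R T v x)"
    using r[OF v] by (simp add: T_def)
  have linT: "linear (T v)" using linear_familyD(1)[OF T] v by simp
  obtain c where c: "l = complex_of_real c"
    by (rule that[of "Re l"]) (simp add: complex_eq_iff facts(1))
  show ?thesis
  proof (rule that)
    show "?r v * c \<noteq> 0" using r[OF v] l by (simp add: c)
    have "lin_trace (T v) = (real DIM('a) - 1) * c" using facts(3) by (simp add: c)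
    then show "lin_trace (Jacobi_op A v) = (real DIM('a) - 1) * (?r v * c)"
      using arg_cong[OF J, of lin_trace] by (simp add: lin_trace_scale)
    have "Spec (Jacobi_op A v) = (\<lambda>z. complex_of_real (?r v) * z) ` {0, l}"
      using arg_cong[OF J, of Spec] Spec_scale[OF linT, of "?r v"] r[OF v] spec[OF v] facts(2) by simp
    then show "Spec (Jacobi_op A v) = {0, complex_of_real (?r v * c)}"
      by (simp add: c)
  qed
qed

section \<open>The spectrum of an affine projective Osserman model\<close>

theorem theorem1p10:
  fixes A :: "'a::euclidean_space \<Rightarrow> 'a \<Rightarrow> 'a \<Rightarrow> 'a"
  assumes "affine_projective_Osserman A"
    and "odd DIM('a)"
  shows "(\<exists>lam :: 'a \<Rightarrow> real.
            smooth_on lam (UNIV - {0}) \<and>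
            (\<forall>v. v \<noteq> 0 \<longrightarrow>
               lam v \<noteq> 0 \<and>
               Spec (Jacobi_op A v) = {0, complex_of_real (lam v)} \<and>
               alg_mult (Jacobi_op A v) 0 = 1 \<and>
               alg_mult (Jacobi_op A v) (complex_of_real (lam v)) = DIM('a) - 1 \<and>
               Ricci A v v = (real DIM('a) - 1) * lam v))
         \<and> definite_inner_product (Ricci_sym A)"
proof -
  have A: "affine_curvature_model A"
    by (rule assms(1)[unfolded affine_projective_Osserman_def, THEN conjunct1])
  have spectrum: "\<exists>l. l \<noteq> 0 \<and> Spec (Jacobi_op A v) = {0, complex_of_real l} \<and>
      lin_trace (Jacobi_op A v) = (real DIM('a) - 1) * l" if v: "v \<noteq> 0" for v
  proof -
    define u where "u = v /\<^sub>R norm v"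
    have "norm u = 1" using v by (simp add: u_def)
    then obtain l where l: "l \<noteq> 0" "Spec (Jacobi_op A u) = {0, complex_of_real l}"
      "lin_trace (Jacobi_op A u) = (real DIM('a) - 1) * l"
      by (rule Osserman_unit_spectrum[OF assms])
    have J: "Jacobi_op A v = (\<lambda>x. (norm v)\<^sup>2 *\<^sub>R Jacobi_op A u x)"
      using Jacobi_scale[OF A, of "norm v" u] v by (simp add: u_def)
    show ?thesis
    proof (intro exI conjI)
      show "(norm v)\<^sup>2 * l \<noteq> 0" using v l by simp
      show "Spec (Jacobi_op A v) = {0, complex_of_real ((norm v)\<^sup>2 * l)}"
        using v by (subst J) (simp add: Spec_scale[OF linear_Jacobi[OF A]] l)
      show "lin_trace (Jacobi_op A v) = (real DIM('a) - 1) * ((norm v)\<^sup>2 * l)"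
        by (subst J) (simp add: lin_trace_scale l)
    qed
  qed
  obtain lam where lam: "\<And>v. v \<noteq> 0 \<Longrightarrow> lam v \<noteq> 0 \<and> Spec (Jacobi_op A v) = {0, complex_of_real (lam v)} \<and>
      lin_trace (Jacobi_op A v) = (real DIM('a) - 1) * lam v"
    using spectrum by metis
  have mult: "alg_mult (Jacobi_op A v) 0 = 1 \<and> alg_mult (Jacobi_op A v) (complex_of_real (lam v)) = DIM('a) - 1 \<and> DIM('a) \<noteq> 1"
    if v: "v \<noteq> 0" for v
  proof -
    note m = multiplicities_two_eigenvalues[of "Jacobi_op A v" "lam v"]
    have "real (alg_mult (Jacobi_op A v) (complex_of_real (lam v))) = real DIM('a) - 1"
      using m(1) lam[OF v] by simp
    then have 1: "alg_mult (Jacobi_op A v) (complex_of_real (lam v)) = DIM('a) - 1"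
      by (simp add: of_nat_diff)
    moreover have "alg_mult (Jacobi_op A v) 0 + alg_mult (Jacobi_op A v) (complex_of_real (lam v)) = DIM('a)"
      using m(2) lam[OF v] by simp
    then have "alg_mult (Jacobi_op A v) 0 = 1"
      using 1 DIM_positive[where 'a='a] by linarith
    moreover have "alg_mult (Jacobi_op A v) (complex_of_real (lam v)) \<noteq> 0"
      using lam[OF v] order_root[of "lin_char_poly (Jacobi_op A v)" "complex_of_real (lam v)"] lin_char_poly_nonzero[of "Jacobi_op A v"]
      by (auto simp: alg_mult_def Spec_def set_eq_iff)
    ultimately show ?thesis by auto
  qed
  have "(SOME b::'a. b \<in> Basis) \<noteq> 0"
    by (metis nonempty_Basis nonzero_Basis some_in_eq)
  from mult[OF this] have dim: "real DIM('a) - 1 > 0"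
    using DIM_positive[where 'a='a] by linarith
  define B where "B = Ricci A"
  have B: "bilinear B" unfolding B_def by (rule bilinear_Ricci[OF A])
  have Blam: "B v v = (real DIM('a) - 1) * lam v" if "v \<noteq> 0" for v
    using lam[OF that] by (simp add: B_def Ricci_diagonal)
  define \<mu> where "\<mu> = (\<lambda>v. B v v / (real DIM('a) - 1))"
  have \<mu>: "\<mu> v = lam v" if "v \<noteq> 0" for v
    using Blam[OF that] dim by (simp add: \<mu>_def)
  have "smooth_on \<mu> (UNIV - {0})"
  proof -
    have "bilinear (\<lambda>x y. B x y / (real DIM('a) - 1))"
      unfolding bilinear_def
      by (auto intro!: linearI simp: add_divide_distrib
          bilinear_ladd[OF B] bilinear_radd[OF B] bilinear_lmul[OF B] bilinear_rmul[OF B])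
    then show ?thesis
      unfolding \<mu>_def by (rule smooth_on_quadratic)
  qed
  moreover have "\<forall>v. v \<noteq> 0 \<longrightarrow> \<mu> v \<noteq> 0 \<and> Spec (Jacobi_op A v) = {0, complex_of_real (\<mu> v)} \<and>
               alg_mult (Jacobi_op A v) 0 = 1 \<and>
               alg_mult (Jacobi_op A v) (complex_of_real (\<mu> v)) = DIM('a) - 1 \<and>
               Ricci A v v = (real DIM('a) - 1) * \<mu> v"
    using lam mult \<mu> Blam by (simp add: B_def)
  moreover have "definite_inner_product (Ricci_sym A)"
  proof -
    have diag: "Ricci_sym A x x = B x x" for x by (simp add: Ricci_sym_def B_def)
    have nz: "B x x \<noteq> 0" if "x \<noteq> 0" for x
      using Blam[OF that] lam[OF that] dim by simp
    have conn: "connected ((\<lambda>x. B x x) ` (UNIV - {0}))"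
    proof (rule connected_continuous_image)
      show "continuous_on (UNIV - {0}) (\<lambda>x. B x x)"
        using bounded_bilinear.continuous_on[OF B[unfolded bilinear_conv_bounded_bilinear] continuous_on_id continuous_on_id] .
      show "connected (UNIV - {0 :: 'a})"
        using connected_punctured_universe[of "0::'a"] dim by (simp add: Compl_eq_Diff_UNIV)
    qed
    have sign: "(\<forall>x. x \<noteq> 0 \<longrightarrow> B x x > 0) \<or> (\<forall>x. x \<noteq> 0 \<longrightarrow> B x x < 0)"
    proof (rule ccontr)
      assume "\<not> ?thesis"
      then obtain x y where "x \<noteq> 0" "B x x \<le> 0" "y \<noteq> 0" "0 \<le> B y y" by force
      then have "0 \<in> (\<lambda>x. B x x) ` (UNIV - {0})"
        using connectedD_interval[OF conn, of "B x x" "B y y" 0] by auto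
      then obtain u where "0 = B u u" "u \<in> UNIV - {0}" by (rule imageE)
      then show False using nz[of u] by simp
    qed
    have "bilinear (Ricci_sym A)"
      unfolding bilinear_def Ricci_sym_def[abs_def] B_def[symmetric]
      by (auto intro!: linearI simp: add_divide_distrib distrib_left
          bilinear_ladd[OF B] bilinear_radd[OF B] bilinear_lmul[OF B] bilinear_rmul[OF B])
    moreover have "Ricci_sym A x y = Ricci_sym A y x" for x y by (simp add: Ricci_sym_def)
    moreover have "x = 0" if "\<forall>y. Ricci_sym A x y = 0" for x
      using that diag nz by metis
    ultimately show ?thesis
      unfolding definite_inner_product_def diag using sign by blast
  qed
  ultimately show ?thesis by blast
qed

end
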